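(* Let $\ell_{\mathrm B}(p,y)=\frac12(p-y)^2$, let $\mathcal X=[1/4,3/4]\times[0,1/8]$, and let $\mathcal H_\star=\{h_0,h_+,h_-\}$ with $h_0(q,s)=q$, $h_+(q,s)=q+s$, $h_-(q,s)=q-s$. Then $$\inf_{\text{learners}}\ \sup_{\text{adversaries}}\ \mathbb E\,\mathrm{SwapReg}_T(\ell_{\mathrm B},\mathcal H_\star)=\Theta(T^{1/3})$$ up to logarithmic factors and universal constants; that is, there are universal constants $c,C,k>0$ and $T_0$ such that for all $T\ge T_0$ the left-hand side lies between $cT^{1/3}$ and $CT^{1/3}(\log T)^k$.
   Context: The infimum is over grid sizes $N$ and randomized online learners predicting on $\Gamma_N=\{0,1/N,\dots,1\}$ (which may depend on $T$); the supremum is over nonanticipating environments. Online protocol: at round $t=1,\dots,T$, nature reveals $x_t\in\mathcal X$; the learner announces a distribution $\psi_t$ on $\Gamma_N$ (a function of the past transcript $(x_s,p_s,y_s)_{s<t}$ and of $x_t$); the learner privately draws $p_t\sim\psi_t$; nature reveals $y_t\in\{0,1\}$. The environment is adaptive and nonanticipating: $x_t$ and $y_t$ may depend arbitrarily (possibly randomly) on the past, and $y_t$ also on $x_t,\psi_t$, but $y_t$ cannot depend on the fresh draw $p_t$. Swap regret: $$\mathrm{SwapReg}_T(\ell,\mathcal H)=\sup_{\phi:\Gamma_N\to\mathcal H}\sum_{t=1}^T\big[\ell(p_t,y_t)-\ell(\phi(p_t)(x_t),y_t)\big].$$ *)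

theory Defs
  imports "HOL-Probability.Probability"
begin

definition forecast_grid :: "nat \<Rightarrow> real set" where
  "forecast_grid N = {real i / real N | i. i \<le> N}"

text \<open>
  A round is recorded as a triple \<open>(x, p, y)\<close>.  A transcript of \<open>t\<close> rounds is a point of
  \<open>transcript_space X N t\<close>, a function on \<open>{0..<t}\<close>; rounds are numbered from \<open>0\<close>.
\<close>

definition instance_space :: "'x::topological_space set \<Rightarrow> 'x measure" where
  "instance_space X = restrict_space borel X"

definition forecast_space :: "nat \<Rightarrow> real measure" where
  "forecast_space N = count_space (forecast_grid N)"

definition outcome_space :: "real measure" where
  "outcome_space = count_space {0, 1}"

type_synonym 'x round = "'x \<times> real \<times> real"
type_synonym 'x transcript = "nat \<Rightarrow> 'x round"

definition round_space :: "'x::topological_space set \<Rightarrow> nat \<Rightarrow> 'x round measure" where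
  "round_space X N = instance_space X \<Otimes>\<^sub>M (forecast_space N \<Otimes>\<^sub>M outcome_space)"

definition transcript_space ::
    "'x::topological_space set \<Rightarrow> nat \<Rightarrow> nat \<Rightarrow> 'x transcript measure" where
  "transcript_space X N t = PiM {0..<t} (\<lambda>_. round_space X N)"

text \<open>
  Strategies are Markov kernels, i.e. measurable maps into the space of probability measures.
  The last argument of an outcome strategy is the distribution announced by the learner; the
  learner's draw from it in the current round is not an argument.  The distributions announced
  in past rounds are functions of the transcript, since the adversary is chosen after the learner.
\<close>

type_synonym 'x learner = "nat \<Rightarrow> 'x transcript \<Rightarrow> 'x \<Rightarrow> real measure"
type_synonym 'x instance_strategy = "nat \<Rightarrow> 'x transcript \<Rightarrow> 'x measure"
type_synonym 'x outcome_strategy = "nat \<Rightarrow> 'x transcript \<Rightarrow> 'x \<Rightarrow> real measure \<Rightarrow> real measure"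

definition learners :: "'x::topological_space set \<Rightarrow> nat \<Rightarrow> 'x learner set" where
  "learners X N = {L. \<forall>t.
     (\<lambda>(h, x). L t h x) \<in>
       transcript_space X N t \<Otimes>\<^sub>M instance_space X \<rightarrow>\<^sub>M prob_algebra (forecast_space N)}"

definition instance_strategies ::
    "'x::topological_space set \<Rightarrow> nat \<Rightarrow> 'x instance_strategy set" where
  "instance_strategies X N = {A. \<forall>t.
     A t \<in> transcript_space X N t \<rightarrow>\<^sub>M prob_algebra (instance_space X)}"

definition outcome_strategies ::
    "'x::topological_space set \<Rightarrow> nat \<Rightarrow> 'x outcome_strategy set" where
  "outcome_strategies X N = {B. \<forall>t.
     (\<lambda>(h, x, \<psi>). B t h x \<psi>) \<in>
       transcript_space X N t \<Otimes>\<^sub>M (instance_space X \<Otimes>\<^sub>M prob_algebra (forecast_space N))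
         \<rightarrow>\<^sub>M prob_algebra outcome_space}"

definition environments ::
    "'x::topological_space set \<Rightarrow> nat \<Rightarrow> ('x instance_strategy \<times> 'x outcome_strategy) set" where
  "environments X N = instance_strategies X N \<times> outcome_strategies X N"

definition round_kernel ::
    "'x::topological_space set \<Rightarrow> nat \<Rightarrow> 'x learner \<Rightarrow> 'x instance_strategy \<times> 'x outcome_strategy \<Rightarrow>
      nat \<Rightarrow> 'x transcript \<Rightarrow> 'x round measure" where
  "round_kernel X N L E t h =
    do {
      x \<leftarrow> fst E t h;
      p \<leftarrow> L t h x;
      y \<leftarrow> snd E t h x (L t h x);
      return (round_space X N) (x, p, y)
    }"

definition play_law ::
    "'x::topological_space set \<Rightarrow> nat \<Rightarrow> 'x learner \<Rightarrow> 'x instance_strategy \<times> 'x outcome_strategy \<Rightarrow>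
      nat \<Rightarrow> 'x transcript measure" where
  "play_law X N L E T =
    Ionescu_Tulcea.C (round_kernel X N L E) (\<lambda>_. round_space X N) 0 T (\<lambda>_. undefined)"

lemma round_kernel_measurable:
  assumes L: "L \<in> learners X N" and E: "E \<in> environments X N"
  shows "round_kernel X N L E t \<in> transcript_space X N t \<rightarrow>\<^sub>M prob_algebra (round_space X N)"
proof -
  obtain A B where EE: "E = (A, B)" by force
  have a[measurable]: "A t \<in> transcript_space X N t \<rightarrow>\<^sub>M prob_algebra (instance_space X)"
   and b: "(\<lambda>(h, x, \<psi>). B t h x \<psi>) \<in>
       transcript_space X N t \<Otimes>\<^sub>M (instance_space X \<Otimes>\<^sub>M prob_algebra (forecast_space N))
         \<rightarrow>\<^sub>M prob_algebra outcome_space"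
   and l[measurable]: "(\<lambda>(h, x). L t h x) \<in>
       transcript_space X N t \<Otimes>\<^sub>M instance_space X \<rightarrow>\<^sub>M prob_algebra (forecast_space N)"
    using assms by (auto simp: EE environments_def learners_def instance_strategies_def outcome_strategies_def)
  have b2[measurable]: "(\<lambda>(h, x). B t h x (L t h x)) \<in> transcript_space X N t \<Otimes>\<^sub>M instance_space X \<rightarrow>\<^sub>M prob_algebra outcome_space"
  proof -
    have "(\<lambda>z. (\<lambda>(h, x, \<psi>). B t h x \<psi>) (fst z, snd z, (\<lambda>(h, x). L t h x) z)) \<in> transcript_space X N t \<Otimes>\<^sub>M instance_space X \<rightarrow>\<^sub>M prob_algebra outcome_space"
      by (rule measurable_compose[OF _ b]) measurable
    then show ?thesis by (simp add: case_prod_beta)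
  qed
  show ?thesis
    unfolding round_kernel_def EE fst_conv snd_conv round_space_def
    by measurable
qed

text \<open>Hence \<open>play_law\<close> is a genuine Ionescu-Tulcea composition of probability kernels.\<close>

lemma Ionescu_Tulcea_round_kernel:
  assumes L: "L \<in> learners X N" and E: "E \<in> environments X N"
  shows "Ionescu_Tulcea (round_kernel X N L E) (\<lambda>_. round_space X N)"
proof (rule Ionescu_Tulcea.intro)
  show "round_kernel X N L E i \<in> (\<Pi>\<^sub>M j\<in>{0..<i}. round_space X N) \<rightarrow>\<^sub>M subprob_algebra (round_space X N)" for i
    using measurable_prob_algebraD[OF round_kernel_measurable[OF assms, of i]]
    by (simp add: transcript_space_def)
  show "prob_space (round_kernel X N L E i x)"
    if "x \<in> space (\<Pi>\<^sub>M j\<in>{0..<i}. round_space X N)" for i x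
    using measurable_space[OF round_kernel_measurable[OF assms, of i], of x] that
    by (simp add: transcript_space_def space_prob_algebra)
qed

text \<open>
  The supremum is that of the reals, hence meaningful only when the regrets are bounded
  above, as they are for every finite nonempty \<open>H\<close>.
\<close>

definition swap_regret ::
    "(real \<Rightarrow> real \<Rightarrow> real) \<Rightarrow> ('x \<Rightarrow> real) set \<Rightarrow> nat \<Rightarrow> nat \<Rightarrow> 'x transcript \<Rightarrow> real" where
  "swap_regret loss H N T \<omega> =
    (SUP \<phi> \<in> forecast_grid N \<rightarrow>\<^sub>E H.
       \<Sum>t<T. case \<omega> t of (x, p, y) \<Rightarrow> loss p y - loss (\<phi> p x) y)"

definition expected_swap_regret ::
    "(real \<Rightarrow> real \<Rightarrow> real) \<Rightarrow> 'x::topological_space set \<Rightarrow> ('x \<Rightarrow> real) set \<Rightarrow> nat \<Rightarrow> nat \<Rightarrow>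
      'x learner \<Rightarrow> 'x instance_strategy \<times> 'x outcome_strategy \<Rightarrow> real" where
  "expected_swap_regret loss X H N T L E =
    (\<integral>\<omega>. swap_regret loss H N T \<omega> \<partial>play_law X N L E T)"

definition minimax_swap_regret ::
    "(real \<Rightarrow> real \<Rightarrow> real) \<Rightarrow> 'x::topological_space set \<Rightarrow> ('x \<Rightarrow> real) set \<Rightarrow> nat \<Rightarrow> ereal" where
  "minimax_swap_regret loss X H T =
    (INF N \<in> {1..}. INF L \<in> learners X N. SUP E \<in> environments X N.
       ereal (expected_swap_regret loss X H N T L E))"

definition brier_loss :: "real \<Rightarrow> real \<Rightarrow> real" where
  "brier_loss p y = (p - y)\<^sup>2 / 2"

definition X_star :: "(real \<times> real) set" where
  "X_star = {1/4..3/4} \<times> {0..1/8}"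

definition h_zero :: "real \<times> real \<Rightarrow> real" where "h_zero = (\<lambda>(q, s). q)"
definition h_plus :: "real \<times> real \<Rightarrow> real" where "h_plus = (\<lambda>(q, s). q + s)"
definition h_minus :: "real \<times> real \<Rightarrow> real" where "h_minus = (\<lambda>(q, s). q - s)"

definition H_star :: "(real \<times> real \<Rightarrow> real) set" where
  "H_star = {h_zero, h_plus, h_minus}"

end

theory Submission
  imports Defs
begin

text \<open>
  Upper bound: for every grid point \<open>v\<close> run exponential weights over the comparison class on the
  rounds with forecast \<open>v\<close>; by mixability of the Brier loss its regret is at most \<open>ln (card H)\<close>
  against every comparator simultaneously, so the maximum over \<open>\<phi>\<close> costs nothing inside the expectation.
  Between two adjacent grid points the bucket forecasts cross the diagonal, and a suitable
  randomization of these two points replaces the bucket forecast at an expected cost of \<open>1 / (8 N\<^sup>2)\<close>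
  per round.  With \<open>N\<close> of order \<open>T\<^sup>1\<^sup>/\<^sup>3\<close> the total is of that order, without logarithms.

  Lower bound: nature cycles through \<open>K\<close> targets \<open>q\<close> with \<open>K\<close> of order \<open>T\<^sup>1\<^sup>/\<^sup>3\<close>, keeps \<open>s\<close> of order
  \<open>T\<^sup>-\<^sup>1\<^sup>/\<^sup>3\<close> fixed, and draws \<open>y\<close> with mean \<open>q\<close>.  A forecast outside the cell of its target costs of
  order \<open>1 / K\<^sup>2\<close>.  If forecasts stay in their cells, choosing \<open>h\<^sub>+\<close> or \<open>h\<^sub>-\<close> on each cell by the sign
  of the noise accumulated there gains \<open>s\<close> times the modulus of a random walk of \<open>T / K\<close> steps, cell by
  cell.  Both effects are tracked by a potential that is polynomial in the walks and in the
  discrepancies caused by stray forecasts, and whose drift is bounded below in every round.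
\<close>

section \<open>Expectations along a play\<close>

lemma finite_forecast_grid [simp]: "finite (forecast_grid N)"
proof -
  have "forecast_grid N = (\<lambda>i. real i / real N) ` {..N}"
    by (auto simp: forecast_grid_def)
  then show ?thesis by simp
qed

lemma card_forecast_grid_le: "card (forecast_grid N) \<le> N + 1"
proof -
  have "forecast_grid N = (\<lambda>i. real i / real N) ` {..N}"
    by (auto simp: forecast_grid_def)
  then show ?thesis by (metis card_image_le card_atMost finite_atMost Suc_eq_plus1)
qed

lemma forecast_grid_bounds:
  assumes "v \<in> forecast_grid N" shows "0 \<le> v" "v \<le> 1"
  using assms by (auto simp: forecast_grid_def divide_le_eq_1)

lemma forecast_grid_nonempty: "0 \<in> forecast_grid N"
  by (force simp: forecast_grid_def)

lemma space_instance_space [simp]: "space (instance_space X) = X"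
  by (simp add: instance_space_def space_restrict_space)

lemma space_forecast_space [simp]: "space (forecast_space N) = forecast_grid N"
  by (simp add: forecast_space_def)

lemma space_outcome_space [simp]: "space outcome_space = {0, 1}"
  by (simp add: outcome_space_def)

lemma space_round_space:
  "space (round_space X N) = X \<times> forecast_grid N \<times> {0, 1}"
  by (simp add: round_space_def space_pair_measure)

lemma transcript_space_memD:
  assumes "h \<in> space (transcript_space X N t)" "i < t"
  shows "h i \<in> space (round_space X N)"
  using assms by (auto simp: transcript_space_def space_PiM)

lemma fun_upd_transcript_space:
  assumes "h \<in> space (transcript_space X N t)" "r \<in> space (round_space X N)"
  shows "h(t := r) \<in> space (transcript_space X N (Suc t))"
  using assms by (auto simp: transcript_space_def space_PiM PiE_iff extensional_def)

lemma measurable_transcript_component [measurable]: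
  "i < t \<Longrightarrow> (\<lambda>h. h i) \<in> transcript_space X N t \<rightarrow>\<^sub>M round_space X N"
  unfolding transcript_space_def by measurable

lemma measurable_fun_upd_transcript:
  assumes h: "h \<in> space (transcript_space X N t)"
  shows "fun_upd h t \<in> round_space X N \<rightarrow>\<^sub>M transcript_space X N (Suc t)"
  unfolding transcript_space_def
proof (rule measurable_fun_upd[where J = "{0..<t}"])
  show "(\<lambda>r. h) \<in> round_space X N \<rightarrow>\<^sub>M (\<Pi>\<^sub>M i\<in>{0..<t}. round_space X N)"
    using h by (simp add: transcript_space_def)
qed auto

lemma measurable_round_fst [measurable]: "fst \<in> round_space X N \<rightarrow>\<^sub>M instance_space X"
  and measurable_round_forecast [measurable]: "(\<lambda>r. fst (snd r)) \<in> round_space X N \<rightarrow>\<^sub>M forecast_space N"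
  and measurable_round_outcome [measurable]: "(\<lambda>r. snd (snd r)) \<in> round_space X N \<rightarrow>\<^sub>M outcome_space"
  unfolding round_space_def by measurable

lemma borel_measurable_forecast_space: "f \<in> borel_measurable (forecast_space N)"
  and borel_measurable_outcome_space: "g \<in> borel_measurable outcome_space"
  by (simp_all add: forecast_space_def outcome_space_def)

text \<open>A nonintegrable function has Bochner integral 0, and a probability space is nonempty, so
  that \<open>0 \<le> B\<close>. Hence the pointwise bound alone suffices, without any
  measurability.\<close>

lemma (in prob_space) abs_integral_le_const:
  fixes f :: "'a \<Rightarrow> real"
  assumes "\<And>x. x \<in> space M \<Longrightarrow> \<bar>f x\<bar> \<le> B"
  shows "\<bar>\<integral>x. f x \<partial>M\<bar> \<le> B"
proof (cases "integrable M f")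
  case True
  have "\<bar>\<integral>x. f x \<partial>M\<bar> \<le> (\<integral>x. \<bar>f x\<bar> \<partial>M)"
    using integral_norm_bound[of M f] by simp
  also have "\<dots> \<le> B"
    using True assms by (intro integral_le_const AE_I2) auto
  finally show ?thesis .
next
  case False
  have "0 \<le> B" using assms not_empty by fastforce
  then show ?thesis using False by (simp add: not_integrable_integral_eq)
qed

text \<open>The sign of \<open>c\<close> covers the nonintegrable case, where the integral is 0.
  Thus the upper bound can integrate over instances and outcomes without checking
  integrability.\<close>

lemma (in prob_space) integral_le_nonneg_const:
  fixes f :: "'a \<Rightarrow> real"
  assumes "\<And>x. x \<in> space M \<Longrightarrow> f x \<le> c" "0 \<le> c"
  shows "(\<integral>x. f x \<partial>M) \<le> c"
proof (cases "integrable M f")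
  case True
  then show ?thesis using assms by (intro integral_le_const AE_I2) auto
next
  case False
  then show ?thesis using assms by (simp add: not_integrable_integral_eq)
qed

section \<open>Tower property and drift for the law of a play\<close>

locale forecasting_play =
  fixes X :: "'x::topological_space set" and N :: nat and L :: "'x learner"
    and E :: "'x instance_strategy \<times> 'x outcome_strategy"
  assumes learner: "L \<in> learners X N" and environment: "E \<in> environments X N"
begin

sublocale IT: Ionescu_Tulcea "round_kernel X N L E" "\<lambda>_. round_space X N"
  by (rule Ionescu_Tulcea_round_kernel[OF learner environment])

abbreviation "play \<equiv> play_law X N L E"

lemma initial_transcript: "(\<lambda>_. undefined) \<in> space (PiM {0..<0::nat} M)"
  by (simp add: space_PiM)

lemma prob_space_play: "prob_space (play t)"
  unfolding play_law_def by (rule IT.prob_space_C[OF initial_transcript])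

lemma sets_play [measurable_cong]: "sets (play t) = sets (transcript_space X N t)"
  unfolding play_law_def transcript_space_def
  using IT.sets_C[OF initial_transcript, of t] by simp

lemma space_play [simp]: "space (play t) = space (transcript_space X N t)"
  by (rule sets_eq_imp_space_eq[OF sets_play])

lemma play_0: "play 0 = return (transcript_space X N 0) (\<lambda>_. undefined)"
  by (simp add: play_law_def transcript_space_def)

lemma play_Suc: "play (Suc t) = play t \<bind> IT.eP t"
  by (simp add: play_law_def)

text \<open>\<open>IT.eP t h\<close> is the image of the round kernel under
  \<open>fun_upd h t\<close>, so this is a change of variables.\<close>

lemma integral_eP:
  fixes f :: "'x transcript \<Rightarrow> real"
  assumes h: "h \<in> space (transcript_space X N t)"
    and f: "f \<in> borel_measurable (transcript_space X N (Suc t))"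
  shows "integral\<^sup>L (IT.eP t h) f = (\<integral>r. f (h(t := r)) \<partial>round_kernel X N L E t h)"
  unfolding IT.eP_def
proof (rule integral_distr)
  have "sets (round_kernel X N L E t h) = sets (round_space X N)"
    using h by (intro IT.sets_P) (simp add: transcript_space_def)
  from measurable_fun_upd_transcript[OF h]
  show "fun_upd h t \<in> round_kernel X N L E t h \<rightarrow>\<^sub>M (\<Pi>\<^sub>M i\<in>{0..<Suc t}. round_space X N)"
    by (simp only: measurable_cong_sets[OF \<open>sets _ = _\<close> refl] transcript_space_def)
  show "f \<in> borel_measurable (\<Pi>\<^sub>M i\<in>{0..<Suc t}. round_space X N)"
    using f by (simp only: transcript_space_def)
qed

lemma integrable_play:
  fixes f :: "'x transcript \<Rightarrow> real"
  assumes f: "f \<in> borel_measurable (transcript_space X N t)"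
    and B: "\<And>h. h \<in> space (transcript_space X N t) \<Longrightarrow> \<bar>f h\<bar> \<le> B"
  shows "integrable (play t) f"
proof -
  interpret prob_space "play t" by (rule prob_space_play)
  show ?thesis
  proof (rule integrable_const_bound[where B = B])
    show "AE h in play t. norm (f h) \<le> B"
      by (rule AE_I2) (simp add: B)
    show "f \<in> borel_measurable (play t)"
      using f by (simp only: measurable_cong_sets[OF sets_play refl])
  qed
qed

text \<open>Tower property: the transcript of \<open>Suc t\<close> rounds is drawn by first drawing
  \<open>t\<close> rounds and then one more from the kernel. Boundedness is what makes the integral
  of a bind an iterated integral.\<close>

lemma integral_play_Suc:
  fixes f :: "'x transcript \<Rightarrow> real"
  assumes f: "f \<in> borel_measurable (transcript_space X N (Suc t))"
    and B: "\<And>h. h \<in> space (transcript_space X N (Suc t)) \<Longrightarrow> \<bar>f h\<bar> \<le> B"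
  shows "integral\<^sup>L (play (Suc t)) f =
    (\<integral>h. (\<integral>r. f (h(t := r)) \<partial>round_kernel X N L E t h) \<partial>play t)"
proof -
  interpret prob_space "play t" by (rule prob_space_play)
  have eP: "IT.eP t \<in> play t \<rightarrow>\<^sub>M subprob_algebra (transcript_space X N (Suc t))"
    using IT.measurable_eP[of t] by (simp only: transcript_space_def measurable_cong_sets[OF sets_play refl])
  have "integral\<^sup>L (play (Suc t)) f = (\<integral>h. integral\<^sup>L (IT.eP t h) f \<partial>play t)"
    unfolding play_Suc
  proof (rule integral_bind[where B = B and B' = 1, OF f B eP finite_measure_axioms])
    show "AE h in play t. emeasure (IT.eP t h) (space (IT.eP t h)) \<le> ennreal 1"
      using IT.prob_space_eP[of _ t]
      by (intro AE_I2) (auto simp: transcript_space_def prob_space.emeasure_space_1)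
  qed
  also have "\<dots> = (\<integral>h. (\<integral>r. f (h(t := r)) \<partial>round_kernel X N L E t h) \<partial>play t)"
    by (rule Bochner_Integration.integral_cong[OF refl integral_eP[OF _ f]]) (simp only: space_play)
  finally show ?thesis .
qed

lemma measurable_round_integral:
  fixes f :: "'x transcript \<Rightarrow> real"
  assumes f: "f \<in> borel_measurable (transcript_space X N (Suc t))"
  shows "(\<lambda>h. \<integral>r. f (h(t := r)) \<partial>round_kernel X N L E t h) \<in> borel_measurable (transcript_space X N t)"
proof -
  have "IT.eP t \<in> transcript_space X N t \<rightarrow>\<^sub>M subprob_algebra (transcript_space X N (Suc t))"
    using IT.measurable_eP[of t] by (simp only: transcript_space_def)
  then have "(\<lambda>h. integral\<^sup>L (IT.eP t h) f) \<in> borel_measurable (transcript_space X N t)"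
    by (rule measurable_compose[OF _ integral_measurable_subprob_algebra[OF f]])
  also have "?this \<longleftrightarrow> ?thesis"
    by (rule measurable_cong[OF integral_eP[OF _ f]])
  finally show ?thesis .
qed

text \<open>Induction on the horizon with the tower property; boundedness supplies all
  integrability. Both halves of the minimax bound rest on it: one takes for \<open>f\<close> the
  accumulated rounding loss, the other a penalized negative potential.\<close>

theorem integral_play_le_drift:
  fixes f :: "nat \<Rightarrow> 'x transcript \<Rightarrow> real"
  assumes meas: "\<And>t. f t \<in> borel_measurable (transcript_space X N t)"
    and bdd: "\<And>t. \<exists>B. \<forall>h\<in>space (transcript_space X N t). \<bar>f t h\<bar> \<le> B"
    and step: "\<And>t h. t < T \<Longrightarrow> h \<in> space (transcript_space X N t) \<Longrightarrow>
      (\<integral>r. f (Suc t) (h(t := r)) \<partial>round_kernel X N L E t h) \<le> f t h + d"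
  shows "integral\<^sup>L (play T) (f T) \<le> f 0 (\<lambda>_. undefined) + real T * d"
proof -
  have "integral\<^sup>L (play t) (f t) \<le> f 0 (\<lambda>_. undefined) + real t * d" if "t \<le> T" for t
    using that
  proof (induction t)
    case 0
    have "integral\<^sup>L (play 0) (f 0) = f 0 (\<lambda>_. undefined)"
      unfolding play_0
      by (rule integral_return[OF _ meas]) (simp add: transcript_space_def space_PiM)
    then show ?case by simp
  next
    case (Suc t)
    interpret prob_space "play t" by (rule prob_space_play)
    obtain B where B: "\<And>h. h \<in> space (transcript_space X N (Suc t)) \<Longrightarrow> \<bar>f (Suc t) h\<bar> \<le> B"
      using bdd by meson
    obtain B' where B': "\<And>h. h \<in> space (transcript_space X N t) \<Longrightarrow> \<bar>f t h\<bar> \<le> B'"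
      using bdd by meson
    have int: "integrable (play t) (f t)"
      by (rule integrable_play[OF meas B'])
    have int': "integrable (play t) (\<lambda>h. \<integral>r. f (Suc t) (h(t := r)) \<partial>round_kernel X N L E t h)"
    proof (rule integrable_play[OF measurable_round_integral[OF meas], where B = B])
      fix h assume h: "h \<in> space (transcript_space X N t)"
      interpret \<kappa>: prob_space "round_kernel X N L E t h"
        using IT.prob_space_P[of h t] h by (simp add: transcript_space_def)
      have sp: "space (round_kernel X N L E t h) = space (round_space X N)"
        using IT.space_P[of h t] h by (simp add: transcript_space_def)
      have "\<bar>f (Suc t) (h(t := r))\<bar> \<le> B" if "r \<in> space (round_kernel X N L E t h)" for r
        using that h by (intro B fun_upd_transcript_space) (simp_all add: sp)
      then show "\<bar>\<integral>r. f (Suc t) (h(t := r)) \<partial>round_kernel X N L E t h\<bar> \<le> B"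
        by (rule \<kappa>.abs_integral_le_const)
    qed
    have "integral\<^sup>L (play (Suc t)) (f (Suc t)) \<le> (\<integral>h. f t h + d \<partial>play t)"
    proof (subst integral_play_Suc[OF meas B], assumption, rule integral_mono)
      show "integrable (play t) (\<lambda>h. f t h + d)" using int by simp
      show "integrable (play t) (\<lambda>h. \<integral>r. f (Suc t) (h(t := r)) \<partial>round_kernel X N L E t h)"
        by (fact int')
      show "(\<integral>r. f (Suc t) (h(t := r)) \<partial>round_kernel X N L E t h) \<le> f t h + d"
        if "h \<in> space (play t)" for h
        using that Suc.prems by (intro step) simp_all
    qed
    also have "\<dots> = integral\<^sup>L (play t) (f t) + d"
      using int prob_space by (simp del: space_play)
    finally show ?case using Suc by (simp add: algebra_simps)
  qed
  from this[of T] show ?thesis by simp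
qed

section \<open>Integration against the kernel of one round\<close>

lemma prob_space_round_kernel:
  "h \<in> space (transcript_space X N t) \<Longrightarrow> prob_space (round_kernel X N L E t h)"
  using IT.prob_space_P[of h t] by (simp add: transcript_space_def)

lemma sets_round_kernel:
  "h \<in> space (transcript_space X N t) \<Longrightarrow> sets (round_kernel X N L E t h) = sets (round_space X N)"
  using IT.sets_P[of h t] by (simp add: transcript_space_def)

lemma integrable_round_kernel:
  fixes f :: "'x round \<Rightarrow> real"
  assumes h: "h \<in> space (transcript_space X N t)" and f: "f \<in> borel_measurable (round_space X N)"
    and B: "\<And>r. r \<in> space (round_space X N) \<Longrightarrow> \<bar>f r\<bar> \<le> B"
  shows "integrable (round_kernel X N L E t h) f"
proof -
  interpret prob_space "round_kernel X N L E t h" by (rule prob_space_round_kernel[OF h])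
  show ?thesis
  proof (rule integrable_const_bound[where B = B])
    show "AE r in round_kernel X N L E t h. norm (f r) \<le> B"
      using B sets_eq_imp_space_eq[OF sets_round_kernel[OF h]] by (intro AE_I2) simp
    show "f \<in> borel_measurable (round_kernel X N L E t h)"
      using f by (simp only: measurable_cong_sets[OF sets_round_kernel[OF h] refl])
  qed
qed

lemma prob_space_instance:
  assumes "h \<in> space (transcript_space X N t)"
  shows "prob_space (fst E t h)" "space (fst E t h) = X"
proof -
  have "fst E t \<in> transcript_space X N t \<rightarrow>\<^sub>M prob_algebra (instance_space X)"
    using environment by (auto simp: environments_def instance_strategies_def)
  from measurable_space[OF this assms]
  show "prob_space (fst E t h)" "space (fst E t h) = X"
    by (auto simp: space_prob_algebra dest: sets_eq_imp_space_eq)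
qed

lemma prob_space_forecast:
  assumes "h \<in> space (transcript_space X N t)" "x \<in> X"
  shows "prob_space (L t h x)" "sets (L t h x) = sets (forecast_space N)"
proof -
  have "(\<lambda>(h, x). L t h x) \<in>
      transcript_space X N t \<Otimes>\<^sub>M instance_space X \<rightarrow>\<^sub>M prob_algebra (forecast_space N)"
    using learner by (simp add: learners_def)
  from measurable_space[OF this, of "(h, x)"] assms
  show "prob_space (L t h x)" "sets (L t h x) = sets (forecast_space N)"
    by (auto simp: space_prob_algebra space_pair_measure)
qed

lemma prob_space_outcome:
  assumes h: "h \<in> space (transcript_space X N t)" and x: "x \<in> X"
  shows "prob_space (snd E t h x (L t h x))" "sets (snd E t h x (L t h x)) = sets outcome_space"
proof -
  have "(\<lambda>(h, x, \<psi>). snd E t h x \<psi>) \<in>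
       transcript_space X N t \<Otimes>\<^sub>M (instance_space X \<Otimes>\<^sub>M prob_algebra (forecast_space N))
         \<rightarrow>\<^sub>M prob_algebra outcome_space"
    using environment by (auto simp: environments_def outcome_strategies_def)
  from measurable_space[OF this, of "(h, x, L t h x)"] h x prob_space_forecast[OF h x]
  show "prob_space (snd E t h x (L t h x))" "sets (snd E t h x (L t h x)) = sets outcome_space"
    by (auto simp: space_prob_algebra space_pair_measure)
qed

text \<open>The outcome law depends on the announced distribution \<open>L t h x\<close> but not on
  the draw \<open>p\<close>. Therefore the nested binds turn into an iterated integral whose
  innermost measure is the same for every \<open>p\<close>: this is nonanticipation in the form used
  later. The measurability half is needed when the instance law is a point mass.\<close>

lemma
  fixes f :: "'x round \<Rightarrow> real"
  assumes h: "h \<in> space (transcript_space X N t)"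
    and f [measurable]: "f \<in> borel_measurable (round_space X N)"
    and B: "\<And>r. r \<in> space (round_space X N) \<Longrightarrow> \<bar>f r\<bar> \<le> B"
  shows measurable_integral_round: "(\<lambda>x. \<integral>p. (\<integral>y. f (x, p, y) \<partial>snd E t h x (L t h x)) \<partial>L t h x)
      \<in> borel_measurable (instance_space X)" (is ?meas)
    and integral_round_kernel: "integral\<^sup>L (round_kernel X N L E t h) f =
    (\<integral>x. (\<integral>p. (\<integral>y. f (x, p, y) \<partial>snd E t h x (L t h x)) \<partial>L t h x) \<partial>fst E t h)" (is ?eq)
proof -
  have A: "fst E t h \<in> space (prob_algebra (instance_space X))"
  proof -
    have "fst E t \<in> transcript_space X N t \<rightarrow>\<^sub>M prob_algebra (instance_space X)"
      using environment by (auto simp: environments_def instance_strategies_def)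
    from measurable_space[OF this h] show ?thesis .
  qed
  have "(\<lambda>(h, x). L t h x) \<in>
      transcript_space X N t \<Otimes>\<^sub>M instance_space X \<rightarrow>\<^sub>M prob_algebra (forecast_space N)"
    using learner by (simp add: learners_def)
  from measurable_compose[OF measurable_Pair1'[OF h] this]
  have Lm: "(\<lambda>x. L t h x) \<in> instance_space X \<rightarrow>\<^sub>M prob_algebra (forecast_space N)"
    by simp
  have "(\<lambda>(h, x, \<psi>). snd E t h x \<psi>) \<in>
       transcript_space X N t \<Otimes>\<^sub>M (instance_space X \<Otimes>\<^sub>M prob_algebra (forecast_space N))
         \<rightarrow>\<^sub>M prob_algebra outcome_space"
    using environment by (auto simp: environments_def outcome_strategies_def)
  then have "(\<lambda>x. (\<lambda>(h, x, \<psi>). snd E t h x \<psi>) (h, x, L t h x)) \<in> instance_space X \<rightarrow>\<^sub>M prob_algebra outcome_space"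
    by (rule measurable_compose[rotated]) (use h Lm in measurable)
  then have Bm: "(\<lambda>x. snd E t h x (L t h x)) \<in> instance_space X \<rightarrow>\<^sub>M prob_algebra outcome_space"
    by simp
  note [measurable] = Lm Bm
  have R: "(\<lambda>y. return (round_space X N) (x, p, y)) \<in> outcome_space \<rightarrow>\<^sub>M prob_algebra (round_space X N)"
    if "x \<in> X" "p \<in> forecast_grid N" for x p
  proof (rule measurable_compose[OF _ measurable_return_prob_space])
    show "(\<lambda>y. (x, p, y)) \<in> outcome_space \<rightarrow>\<^sub>M round_space X N"
      unfolding round_space_def using that by (intro measurable_Pair measurable_const) auto
  qed
  \<comment> \<open>One rule for a bind of probability kernels over an arbitrary space; it is
    applied to the instance, the forecast and the outcome in turn.\<close>
  have step: "integral\<^sup>L (M \<bind> K) f = (\<integral>z. integral\<^sup>L (K z) f \<partial>M)"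
    if M: "M \<in> space (prob_algebra S)" and K: "K \<in> S \<rightarrow>\<^sub>M prob_algebra (round_space X N)"
    for M :: "'z measure" and S K
  proof -
    interpret prob_space M using M by (simp add: space_prob_algebra)
    have K': "K \<in> M \<rightarrow>\<^sub>M prob_algebra (round_space X N)"
      using M K by (simp add: space_prob_algebra cong: measurable_cong_sets)
    show ?thesis
    proof (rule integral_bind[where B = B and B' = 1, OF f B measurable_prob_algebraD[OF K'] finite_measure_axioms])
      show "AE z in M. emeasure (K z) (space (K z)) \<le> ennreal 1"
        using measurable_space[OF K']
        by (intro AE_I2) (auto simp: space_prob_algebra prob_space.emeasure_space_1)
    qed
  qed
  have spA: "space (fst E t h) = X"
    using A by (auto simp: space_prob_algebra dest: sets_eq_imp_space_eq)
  have inner: "integral\<^sup>L (L t h x \<bind> (\<lambda>p. snd E t h x (L t h x) \<bind> (\<lambda>y. return (round_space X N) (x, p, y)))) f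
      = (\<integral>p. (\<integral>y. f (x, p, y) \<partial>snd E t h x (L t h x)) \<partial>L t h x)" if x: "x \<in> X" for x
  proof -
    have Lx: "L t h x \<in> space (prob_algebra (forecast_space N))"
      using measurable_space[OF Lm] x by simp
    have Bx: "snd E t h x (L t h x) \<in> space (prob_algebra outcome_space)"
      using measurable_space[OF Bm] x by simp
    have spL: "space (L t h x) = forecast_grid N" and spB: "space (snd E t h x (L t h x)) = {0,1}"
      using Lx Bx by (auto simp: space_prob_algebra dest: sets_eq_imp_space_eq)
    have "(\<lambda>p. snd E t h x (L t h x) \<bind> (\<lambda>y. return (round_space X N) (x, p, y)))
        \<in> forecast_space N \<rightarrow>\<^sub>M prob_algebra (round_space X N)"
    proof (rule measurable_bind_prob_space2[OF measurable_const[OF Bx]])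
      have "(\<lambda>py. return (round_space X N) (x, py)) \<in>
          forecast_space N \<Otimes>\<^sub>M outcome_space \<rightarrow>\<^sub>M prob_algebra (round_space X N)"
        using x unfolding round_space_def
        by (intro measurable_compose[OF measurable_Pair1' measurable_return_prob_space]) simp
      then show "(\<lambda>(p, y). return (round_space X N) (x, p, y)) \<in>
          forecast_space N \<Otimes>\<^sub>M outcome_space \<rightarrow>\<^sub>M prob_algebra (round_space X N)"
        by (simp only: case_prod_beta' prod.collapse)
    qed
    note step[OF Lx this]
    also have "(\<integral>p. integral\<^sup>L (snd E t h x (L t h x) \<bind> (\<lambda>y. return (round_space X N) (x, p, y))) f \<partial>L t h x)
      = (\<integral>p. (\<integral>y. f (x, p, y) \<partial>snd E t h x (L t h x)) \<partial>L t h x)"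
    proof (rule Bochner_Integration.integral_cong[OF refl])
      fix p assume "p \<in> space (L t h x)"
      then have p: "p \<in> forecast_grid N" by (simp add: spL)
      have "integral\<^sup>L (snd E t h x (L t h x) \<bind> (\<lambda>y. return (round_space X N) (x, p, y))) f
        = (\<integral>y. integral\<^sup>L (return (round_space X N) (x, p, y)) f \<partial>snd E t h x (L t h x))"
        by (rule step[OF Bx R[OF x p]])
      also have "\<dots> = (\<integral>y. f (x, p, y) \<partial>snd E t h x (L t h x))"
        by (rule Bochner_Integration.integral_cong[OF refl integral_return[OF _ f]])
          (use x p in \<open>auto simp: space_round_space spB\<close>)
      finally show "integral\<^sup>L (snd E t h x (L t h x) \<bind> (\<lambda>y. return (round_space X N) (x, p, y))) f
        = (\<integral>y. f (x, p, y) \<partial>snd E t h x (L t h x))" .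
    qed
    finally show ?thesis .
  qed
  have K: "(\<lambda>x. L t h x \<bind> (\<lambda>p. snd E t h x (L t h x) \<bind> (\<lambda>y. return (round_space X N) (x, p, y))))
      \<in> instance_space X \<rightarrow>\<^sub>M prob_algebra (round_space X N)"
    unfolding round_space_def by measurable
  have "(\<lambda>x. integral\<^sup>L (L t h x \<bind>
      (\<lambda>p. snd E t h x (L t h x) \<bind> (\<lambda>y. return (round_space X N) (x, p, y)))) f)
      \<in> borel_measurable (instance_space X)"
    by (rule measurable_compose[OF measurable_prob_algebraD[OF K] integral_measurable_subprob_algebra[OF f]])
  also have "?this \<longleftrightarrow> ?meas"
    by (rule measurable_cong[OF inner]) simp
  finally show ?meas .
  have "integral\<^sup>L (round_kernel X N L E t h) f = (\<integral>x. integral\<^sup>L (L t h x \<bind>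
      (\<lambda>p. snd E t h x (L t h x) \<bind> (\<lambda>y. return (round_space X N) (x, p, y)))) f \<partial>fst E t h)"
    unfolding round_kernel_def by (rule step[OF A K])
  also have "\<dots> = (\<integral>x. (\<integral>p. (\<integral>y. f (x, p, y) \<partial>snd E t h x (L t h x)) \<partial>L t h x) \<partial>fst E t h)"
    by (rule Bochner_Integration.integral_cong[OF refl inner]) (simp add: spA)
  finally show ?eq .
qed

end

section \<open>The calibrating learner\<close>

text \<open>The second derivative is \<open>(u\<^sup>2 - 1) * exp (- (u\<^sup>2 / 2))\<close>, which
  is nonpositive exactly on this interval. A difference between a prediction in [0, 1] and an
  outcome never leaves it, so the Brier loss is exp-concave with learning rate 1.\<close>

lemma concave_exp_neg_half_square: "concave_on {-1..1::real} (\<lambda>u. exp (- (u\<^sup>2 / 2)))"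
proof (rule f''_le0_imp_concave)
  show "((\<lambda>u. exp (- (u\<^sup>2 / 2))) has_real_derivative - (u * exp (- (u\<^sup>2 / 2)))) (at u)" for u :: real
    by (auto intro!: derivative_eq_intros)
  show "((\<lambda>u. - (u * exp (- (u\<^sup>2 / 2)))) has_real_derivative (u\<^sup>2 - 1) * exp (- (u\<^sup>2 / 2))) (at u)" for u :: real
    by (auto intro!: derivative_eq_intros simp: algebra_simps power2_eq_square)
  show "(u\<^sup>2 - 1) * exp (- (u\<^sup>2 / 2)) \<le> 0" if "u \<in> {-1..1}" for u :: real
    using that by (auto intro!: mult_nonpos_nonneg simp: abs_square_le_1)
qed simp

lemma brier_loss_nonneg: "0 \<le> brier_loss p y"
  by (simp add: brier_loss_def)

lemma brier_loss_le_half: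
  assumes "p \<in> {0..1}" "y \<in> {0, 1}" shows "brier_loss p y \<le> 1/2"
proof -
  have "\<bar>p - y\<bar> \<le> 1" using assms by auto
  then show ?thesis by (simp add: brier_loss_def abs_square_le_1)
qed

text \<open>Jensen's inequality for the concave function above, at the points \<open>a h - y\<close>
  with the normalized weights, followed by taking logarithms. The right-hand side is the drop of the
  log-partition function in one step of exponential weights, which makes the loss telescope.\<close>

lemma brier_loss_mixable:
  fixes w a :: "'h \<Rightarrow> real"
  assumes H: "finite H" "H \<noteq> {}" and w: "\<And>h. h \<in> H \<Longrightarrow> 0 < w h"
    and a: "\<And>h. h \<in> H \<Longrightarrow> a h \<in> {0..1}" and y: "y \<in> {0, 1}"
  shows "brier_loss ((\<Sum>h\<in>H. w h * a h) / (\<Sum>h\<in>H. w h)) y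
    \<le> ln (\<Sum>h\<in>H. w h) - ln (\<Sum>h\<in>H. w h * exp (- brier_loss (a h) y))"
proof -
  define W where "W = (\<Sum>h\<in>H. w h)"
  have W: "0 < W" unfolding W_def using H w by (intro sum_pos) auto
  have S: "0 < (\<Sum>h\<in>H. w h * exp (- brier_loss (a h) y))"
    using H w by (intro sum_pos) auto
  have mean: "(\<Sum>h\<in>H. (w h / W) *\<^sub>R (a h - y)) = (\<Sum>h\<in>H. w h * a h) / W - y"
  proof -
    have "(\<Sum>h\<in>H. (w h / W) *\<^sub>R (a h - y)) = (\<Sum>h\<in>H. w h * a h / W - w h / W * y)"
      by (rule sum.cong[OF refl]) (simp add: algebra_simps diff_divide_distrib)
    also have "\<dots> = (\<Sum>h\<in>H. w h * a h / W) - (\<Sum>h\<in>H. w h / W) * y"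
      by (simp only: sum_subtractf sum_distrib_right)
    also have "(\<Sum>h\<in>H. w h / W) = 1"
      using W by (simp add: sum_divide_distrib[symmetric] W_def[symmetric])
    finally show ?thesis by (simp add: sum_divide_distrib)
  qed
  have "(\<Sum>h\<in>H. w h / W) = 1"
    using W by (simp add: sum_divide_distrib[symmetric] W_def[symmetric])
  moreover have "0 \<le> w h / W" if "h \<in> H" for h
    using w[OF that] W by simp
  moreover have "a h - y \<in> {-1..1}" if "h \<in> H" for h
    using a[OF that] y by auto
  ultimately have "(\<Sum>h\<in>H. w h / W * exp (- ((a h - y)\<^sup>2 / 2)))
      \<le> exp (- ((\<Sum>h\<in>H. (w h / W) *\<^sub>R (a h - y))\<^sup>2 / 2))"
    using concave_on_sum[OF H concave_exp_neg_half_square, of "\<lambda>h. w h / W" "\<lambda>h. a h - y"] by blast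
  then have "(\<Sum>h\<in>H. w h * exp (- brier_loss (a h) y)) / W \<le> exp (- brier_loss ((\<Sum>h\<in>H. w h * a h) / W) y)"
    unfolding mean by (simp add: brier_loss_def sum_divide_distrib)
  then have "ln ((\<Sum>h\<in>H. w h * exp (- brier_loss (a h) y)) / W)
      \<le> ln (exp (- brier_loss ((\<Sum>h\<in>H. w h * a h) / W) y))"
    using S W by (subst ln_le_cancel_iff) auto
  then show ?thesis
    using S W by (simp add: ln_div W_def)
qed

section \<open>Exponential weights inside one bucket\<close>

definition bucket_loss :: "('x \<Rightarrow> real) \<Rightarrow> real \<Rightarrow> 'x transcript \<Rightarrow> nat \<Rightarrow> real" where
  "bucket_loss h v \<omega> t = (\<Sum>i<t. case \<omega> i of (x, p, y) \<Rightarrow> if p = v then brier_loss (h x) y else 0)"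

text \<open>The exponentially weighted average with learning rate 1 and uniform prior, run
  separately for each grid value \<open>v\<close>. It reads only the first \<open>t\<close> rounds
  of the transcript, so it may be evaluated on a longer one.\<close>

definition bucket_forecast :: "('x \<Rightarrow> real) set \<Rightarrow> nat \<Rightarrow> 'x transcript \<Rightarrow> 'x \<Rightarrow> real \<Rightarrow> real" where
  "bucket_forecast H t \<omega> x v =
    (\<Sum>h\<in>H. exp (- bucket_loss h v \<omega> t) * h x) / (\<Sum>h\<in>H. exp (- bucket_loss h v \<omega> t))"

lemma bucket_loss_cong:
  assumes "\<And>i. i < t \<Longrightarrow> \<omega> i = \<omega>' i"
  shows "bucket_loss h v \<omega> t = bucket_loss h v \<omega>' t"
  unfolding bucket_loss_def using assms by (intro sum.cong) auto

lemma bucket_forecast_cong: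
  assumes "\<And>i. i < t \<Longrightarrow> \<omega> i = \<omega>' i"
  shows "bucket_forecast H t \<omega> x v = bucket_forecast H t \<omega>' x v"
  unfolding bucket_forecast_def using bucket_loss_cong[OF assms] by simp

lemma bucket_forecast_bounds:
  assumes "finite H" "H \<noteq> {}" and h: "\<And>h. h \<in> H \<Longrightarrow> h x \<in> {0..1}"
  shows "bucket_forecast H t \<omega> x v \<in> {0..1}"
proof -
  have pos: "0 < (\<Sum>h\<in>H. exp (- bucket_loss h v \<omega> t))"
    using assms by (intro sum_pos) auto
  have "(\<Sum>h\<in>H. exp (- bucket_loss h v \<omega> t) * h x) \<le> (\<Sum>h\<in>H. exp (- bucket_loss h v \<omega> t) * 1)"
    using h by (intro sum_mono mult_left_mono) auto
  moreover have "0 \<le> (\<Sum>h\<in>H. exp (- bucket_loss h v \<omega> t) * h x)"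
    using h by (intro sum_nonneg mult_nonneg_nonneg) auto
  ultimately show ?thesis
    using pos by (auto simp: bucket_forecast_def divide_le_eq_1)
qed

text \<open>The partition function \<open>Z\<close> starts at \<open>card H\<close>, and its final
  value is at least the single summand belonging to \<open>g\<close>. In between, each loss in the
  bucket is at most the drop of \<open>ln Z\<close>. The algorithm does not depend on
  \<open>g\<close>, so the bound holds for all comparators at once.\<close>

lemma bucket_regret_le:
  assumes H: "finite H" "g \<in> H" and range: "H \<subseteq> X \<rightarrow> {0..1}"
    and \<omega>: "\<And>i. i < T \<Longrightarrow> \<omega> i \<in> space (round_space X N)"
  shows "(\<Sum>i<T. case \<omega> i of (x, p, y) \<Rightarrow>
      if p = v then brier_loss (bucket_forecast H i \<omega> x v) y - brier_loss (g x) y else 0) \<le> ln (card H)"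
proof -
  define Z where "Z t = (\<Sum>h\<in>H. exp (- bucket_loss h v \<omega> t))" for t
  have Zpos: "0 < Z t" for t
    unfolding Z_def using H by (intro sum_pos) auto
  have *: "(\<Sum>i<t. case \<omega> i of (x, p, y) \<Rightarrow>
      if p = v then brier_loss (bucket_forecast H i \<omega> x v) y else 0) \<le> ln (Z 0) - ln (Z t)" if "t \<le> T" for t
    using that
  proof (induction t)
    case 0 then show ?case by simp
  next
    case (Suc t)
    obtain x p y where xy: "\<omega> t = (x, p, y)" by (cases "\<omega> t")
    then have "x \<in> X" "y \<in> {0, 1}" using \<omega>[of t] Suc.prems by (auto simp: space_round_space)
    have hx: "h x \<in> {0..1}" if "h \<in> H" for h
      using subsetD[OF range that] \<open>x \<in> X\<close> by auto
    \<comment> \<open>Inside the bucket this is mixability; in a round with another forecast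
      \<open>Z\<close> does not move.\<close>
    have "(if p = v then brier_loss (bucket_forecast H t \<omega> x v) y else 0) \<le> ln (Z t) - ln (Z (Suc t))"
    proof (cases "p = v")
      case True
      have "Z (Suc t) = (\<Sum>h\<in>H. exp (- bucket_loss h v \<omega> t) * exp (- brier_loss (h x) y))"
        unfolding Z_def using True by (intro sum.cong) (auto simp: bucket_loss_def xy exp_add[symmetric])
      then show ?thesis
        using brier_loss_mixable[of H "\<lambda>h. exp (- bucket_loss h v \<omega> t)" "\<lambda>h. h x" y] H hx \<open>y \<in> {0, 1}\<close> True
        by (auto simp: bucket_forecast_def Z_def)
    next
      case False
      then show ?thesis by (simp add: Z_def bucket_loss_def xy)
    qed
    then show ?case using Suc by (simp add: xy)
  qed
  have "exp (- bucket_loss g v \<omega> T) \<le> Z T"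
    unfolding Z_def using H by (intro member_le_sum) auto
  then have "- bucket_loss g v \<omega> T \<le> ln (Z T)"
    using Zpos[of T] by (simp add: ln_ge_iff)
  moreover have "Z 0 = card H" by (simp add: Z_def bucket_loss_def)
  moreover have "(\<Sum>i<T. case \<omega> i of (x, p, y) \<Rightarrow>
      if p = v then brier_loss (bucket_forecast H i \<omega> x v) y - brier_loss (g x) y else 0) =
    (\<Sum>i<T. case \<omega> i of (x, p, y) \<Rightarrow>
      if p = v then brier_loss (bucket_forecast H i \<omega> x v) y else 0) - bucket_loss g v \<omega> T"
    unfolding bucket_loss_def sum_subtractf[symmetric] by (intro sum.cong) (auto split: prod.split)
  ultimately show ?thesis using *[of T] by simp
qed

section \<open>Randomization where the bucket forecasts cross the diagonal\<close>

definition crossing :: "nat \<Rightarrow> (real \<Rightarrow> real) \<Rightarrow> nat" where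
  "crossing N w = (LEAST i. w (real (Suc i) / real N) \<le> real (Suc i) / real N)"

text \<open>The probability of the upper point is the gap at the lower point divided by the sum of
  both gaps, so that probability times gap agrees at the two points. If both gaps vanish, division
  by zero gives 0 and the lower point is played.\<close>

definition crossing_prob :: "nat \<Rightarrow> (real \<Rightarrow> real) \<Rightarrow> nat \<Rightarrow> real" where
  "crossing_prob N w i =
    (w (real i / real N) - real i / real N) /
    ((w (real i / real N) - real i / real N) + (real (Suc i) / real N - w (real (Suc i) / real N)))"

definition crossing_weight :: "nat \<Rightarrow> (real \<Rightarrow> real) \<Rightarrow> nat \<Rightarrow> real \<Rightarrow> real" where
  "crossing_weight N w i u =
    (1 - crossing_prob N w i) * of_bool (u = real i / real N) +
    crossing_prob N w i * of_bool (u = real (Suc i) / real N)"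

text \<open>A discrete intermediate value argument: at the grid point 1 the value of
  \<open>w\<close> is at most 1, so the search stops by index \<open>N - 1\<close>. By minimality
  \<open>w\<close> exceeds the diagonal at the left neighbour, or else this neighbour is 0, where
  \<open>w\<close> is nonnegative.\<close>

lemma crossing:
  assumes N: "1 \<le> N" and w: "\<And>v. v \<in> forecast_grid N \<Longrightarrow> w v \<in> {0..1}"
  defines "i \<equiv> crossing N w"
  shows "i < N" "real i / real N \<le> w (real i / real N)" "w (real (Suc i) / real N) \<le> real (Suc i) / real N"
proof -
  have "1 \<in> forecast_grid N" using N by (force simp: forecast_grid_def)
  then have last: "w (real (Suc (N - 1)) / real N) \<le> real (Suc (N - 1)) / real N"
    using w[of 1] N by simp
  then show "w (real (Suc i) / real N) \<le> real (Suc i) / real N"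
    unfolding i_def crossing_def by (rule LeastI)
  have "i \<le> N - 1" unfolding i_def crossing_def by (rule Least_le) (fact last)
  then show "i < N" using N by simp
  show "real i / real N \<le> w (real i / real N)"
  proof (cases i)
    case 0
    then show ?thesis using w[OF forecast_grid_nonempty] by simp
  next
    case (Suc j)
    then have "\<not> w (real (Suc j) / real N) \<le> real (Suc j) / real N"
      using not_less_Least[of j "\<lambda>i. w (real (Suc i) / real N) \<le> real (Suc i) / real N"]
      by (simp add: i_def crossing_def)
    then show ?thesis by (simp add: Suc)
  qed
qed

lemma crossing_prob_bounds:
  assumes "1 \<le> N" "\<And>v. v \<in> forecast_grid N \<Longrightarrow> w v \<in> {0..1}"
  shows "crossing_prob N w (crossing N w) \<in> {0..1}"
proof -
  have "a / (a + b) \<in> {0..1}" if "0 \<le> a" "0 \<le> b" for a b :: real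
    using that by (auto simp: divide_le_eq_1)
  then show ?thesis
    unfolding crossing_prob_def using crossing(2,3)[of N w] assms by simp
qed

text \<open>
  The two adjacent grid points are randomized so that the first-order terms of the two loss
  differences cancel up to the grid spacing; the quadratic terms absorb what is left.
\<close>

lemma crossing_loss_le:
  fixes v v' a b y :: real
  assumes ab: "0 \<le> a" "0 \<le> b"
  defines "\<theta> \<equiv> a / (a + b)"
  shows "(1 - \<theta>) * (brier_loss v y - brier_loss (v + a) y) + \<theta> * (brier_loss v' y - brier_loss (v' - b) y)
    \<le> (v' - v)\<^sup>2 / 8"
proof (cases "a + b = 0")
  case True
  then have "a = 0" "b = 0" using ab by auto
  then show ?thesis by simp
next
  case False
  then have pos: "0 < a + b" using ab by simp
  \<comment> \<open>The common value of probability times gap at the two points. As it multiplies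
    \<open>y\<close> with opposite signs, the outcome drops out of the mixture.\<close>
  define m where "m = a * b / (a + b)"
  have 1: "1 - \<theta> = b / (a + b)" using pos by (simp add: \<theta>_def field_simps)
  have ma: "(1 - \<theta>) * a = m" and mb: "\<theta> * b = m"
    unfolding 1 by (simp_all add: m_def \<theta>_def)
  have "(1 - \<theta>) * (brier_loss v y - brier_loss (v + a) y) = ((1 - \<theta>) * a) * (y - v - a / 2)"
    by (simp add: brier_loss_def power2_eq_square field_simps)
  moreover have "\<theta> * (brier_loss v' y - brier_loss (v' - b) y) = (\<theta> * b) * (v' - y - b / 2)"
    by (simp add: brier_loss_def power2_eq_square field_simps)
  ultimately have "(1 - \<theta>) * (brier_loss v y - brier_loss (v + a) y) + \<theta> * (brier_loss v' y - brier_loss (v' - b) y)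
      = m * (v' - v) - m * (a + b) / 2"
    unfolding ma mb by (simp add: algebra_simps add_divide_distrib)
  also have "\<dots> \<le> m * (v' - v) - 2 * m\<^sup>2"
  proof -
    have "4 * (a * b) \<le> (a + b)\<^sup>2"
      using sum_squares_bound[of a b] by (simp add: power2_sum)
    then have "4 * m \<le> a + b"
      using pos by (simp add: m_def power2_eq_square divide_le_eq)
    moreover have "0 \<le> m" using ab by (simp add: m_def)
    ultimately have "m * (4 * m) \<le> m * (a + b)" by (rule mult_left_mono)
    then show ?thesis by (simp add: power2_eq_square)
  qed
  \<comment> \<open>The quadratic in \<open>m\<close> is maximal at a quarter of the grid spacing;
    completing the square gives the constant 8.\<close>
  also have "\<dots> \<le> (v' - v)\<^sup>2 / 8"
    using zero_le_power2[of "4 * m - (v' - v)"] by (simp add: power2_diff power_mult_distrib)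
  finally show ?thesis .
qed

section \<open>Measurability of the learner\<close>

lemma borel_measurable_brier_loss [measurable (raw)]:
  assumes "f \<in> borel_measurable M" "g \<in> borel_measurable M"
  shows "(\<lambda>z. brier_loss (f z) (g z)) \<in> borel_measurable M"
  unfolding brier_loss_def using assms by measurable

lemma abs_brier_loss_diff_le:
  assumes "p \<in> {0..1}" "q \<in> {0..1}" "y \<in> {0, 1}"
  shows "\<bar>brier_loss p y - brier_loss q y\<bar> \<le> 1/2"
  using brier_loss_le_half[of p y] brier_loss_le_half[of q y]
    brier_loss_nonneg[of p y] brier_loss_nonneg[of q y] assms
  by linarith

text \<open>The bucket and the transcript may vary jointly with a point of an arbitrary space
  \<open>M\<close>. This covers both a fixed grid value, as in the learner's kernel, and the random
  forecast of the current round, as in the rounding loss.\<close>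

lemma measurable_bucket_loss:
  assumes h: "h \<in> borel_measurable (instance_space X)" and "t \<le> T"
    and \<omega>: "\<omega> \<in> M \<rightarrow>\<^sub>M transcript_space X N T" and v: "v \<in> borel_measurable M"
  shows "(\<lambda>z. bucket_loss h (v z) (\<omega> z) t) \<in> borel_measurable M"
  unfolding bucket_loss_def
proof (rule borel_measurable_sum)
  fix i assume "i \<in> {..<t}"
  then have r: "(\<lambda>z. \<omega> z i) \<in> M \<rightarrow>\<^sub>M round_space X N"
    using \<open>t \<le> T\<close> by (intro measurable_compose[OF \<omega> measurable_transcript_component]) simp
  have [measurable]: "(\<lambda>z. h (fst (\<omega> z i))) \<in> borel_measurable M"
    by (rule measurable_compose[OF measurable_compose[OF r measurable_round_fst] h])
  have [measurable]: "(\<lambda>z. fst (snd (\<omega> z i))) \<in> borel_measurable M"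
    by (rule measurable_compose[OF measurable_compose[OF r measurable_round_forecast] borel_measurable_forecast_space])
  have [measurable]: "(\<lambda>z. snd (snd (\<omega> z i))) \<in> borel_measurable M"
    by (rule measurable_compose[OF measurable_compose[OF r measurable_round_outcome] borel_measurable_outcome_space])
  note [measurable] = v
  show "(\<lambda>z. case \<omega> z i of (x, p, y) \<Rightarrow> if p = v z then brier_loss (h x) y else 0) \<in> borel_measurable M"
    unfolding case_prod_beta by measurable
qed

lemma measurable_bucket_forecast:
  assumes H: "H \<subseteq> borel_measurable (instance_space X)" and "t \<le> T"
    and \<omega>: "\<omega> \<in> M \<rightarrow>\<^sub>M transcript_space X N T" and x: "x \<in> M \<rightarrow>\<^sub>M instance_space X"
    and v: "v \<in> borel_measurable M"
  shows "(\<lambda>z. bucket_forecast H t (\<omega> z) (x z) (v z)) \<in> borel_measurable M"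
  unfolding bucket_forecast_def
  using measurable_bucket_loss[OF subsetD[OF H] \<open>t \<le> T\<close> \<omega> v] measurable_compose[OF x subsetD[OF H]]
  by (intro borel_measurable_divide borel_measurable_sum borel_measurable_times
      borel_measurable_exp borel_measurable_uminus) simp_all

definition crossing_distribution :: "nat \<Rightarrow> (real \<Rightarrow> real) \<Rightarrow> real measure" where
  "crossing_distribution N w = point_measure (forecast_grid N) (crossing_weight N w (crossing N w))"

definition calibrating_learner :: "('x \<Rightarrow> real) set \<Rightarrow> nat \<Rightarrow> 'x learner" where
  "calibrating_learner H N t \<omega> x = crossing_distribution N (bucket_forecast H t \<omega> x)"

lemma sum_crossing_weight:
  assumes "i < N"
  shows "(\<Sum>u\<in>forecast_grid N. crossing_weight N w i u * g u) =
    (1 - crossing_prob N w i) * g (real i / real N) + crossing_prob N w i * g (real (Suc i) / real N)"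
proof -
  have "real i / real N \<in> forecast_grid N" "real (Suc i) / real N \<in> forecast_grid N"
    using assms unfolding forecast_grid_def by (auto intro: exI[of _ i] exI[of _ "Suc i"] simp del: of_nat_Suc)
  then show ?thesis
    by (simp add: crossing_weight_def distrib_right sum.distrib mult.assoc sum_distrib_left[symmetric]
        of_bool_def if_distrib[of "\<lambda>c. c * _"] sum.delta' del: of_nat_Suc cong: if_cong)
qed

lemma crossing_weight_nonneg:
  assumes "1 \<le> N" "\<And>v. v \<in> forecast_grid N \<Longrightarrow> w v \<in> {0..1}"
  shows "0 \<le> crossing_weight N w (crossing N w) u"
  using crossing_prob_bounds[of N w] assms by (simp add: crossing_weight_def)

lemma integral_crossing_distribution:
  fixes g :: "real \<Rightarrow> real"
  assumes "1 \<le> N" "\<And>v. v \<in> forecast_grid N \<Longrightarrow> w v \<in> {0..1}"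
  defines "i \<equiv> crossing N w"
  shows "integral\<^sup>L (crossing_distribution N w) g =
    (1 - crossing_prob N w i) * g (real i / real N) + crossing_prob N w i * g (real (Suc i) / real N)"
proof -
  have "integral\<^sup>L (crossing_distribution N w) g = (\<Sum>u\<in>forecast_grid N. crossing_weight N w i u * g u)"
    unfolding crossing_distribution_def i_def using crossing_weight_nonneg[OF assms(1,2)]
    by (subst lebesgue_integral_point_measure_finite) simp_all
  also have "i < N" unfolding i_def by (rule crossing(1)[OF assms(1,2)])
  note sum_crossing_weight[OF this]
  finally show ?thesis .
qed

lemma prob_space_crossing_distribution:
  assumes "1 \<le> N" "\<And>v. v \<in> forecast_grid N \<Longrightarrow> w v \<in> {0..1}"
  shows "prob_space (crossing_distribution N w)"
proof
  have "(\<Sum>u\<in>forecast_grid N. crossing_weight N w (crossing N w) u) = 1"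
    using sum_crossing_weight[where w = w and g = "\<lambda>_. 1" and i = "crossing N w" and N = N]
      crossing(1)[where w = w and N = N] assms by simp
  then show "emeasure (crossing_distribution N w) (space (crossing_distribution N w)) = 1"
    unfolding crossing_distribution_def using crossing_weight_nonneg[OF assms]
    by (simp add: space_point_measure emeasure_point_measure_finite sum_ennreal)
qed

text \<open>For a fixed index the weights are rational expressions in the values of
  \<open>w\<close>. The crossing index is a measurable natural number, so the countably many cases
  can be patched together.\<close>

lemma measurable_crossing_distribution:
  fixes w :: "'z \<Rightarrow> real \<Rightarrow> real"
  assumes "1 \<le> N" and range: "\<And>z v. z \<in> space M \<Longrightarrow> v \<in> forecast_grid N \<Longrightarrow> w z v \<in> {0..1}"
    and w [measurable]: "\<And>v. (\<lambda>z. w z v) \<in> borel_measurable M"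
  shows "(\<lambda>z. crossing_distribution N (w z)) \<in> M \<rightarrow>\<^sub>M prob_algebra (forecast_space N)"
proof (rule measurable_prob_algebra_generated[where G = "Pow (forecast_grid N)"])
  have cross [measurable]: "(\<lambda>z. crossing N (w z)) \<in> M \<rightarrow>\<^sub>M count_space UNIV"
    unfolding crossing_def by measurable
  have weight: "(\<lambda>z. crossing_weight N (w z) (crossing N (w z)) u) \<in> borel_measurable M" for u
  proof (rule measurable_compose_countable[OF _ cross])
    show "(\<lambda>z. crossing_weight N (w z) i u) \<in> borel_measurable M" for i
      unfolding crossing_weight_def crossing_prob_def by measurable
  qed
  show "sets (forecast_space N) = sigma_sets (forecast_grid N) (Pow (forecast_grid N))"
    by (simp add: forecast_space_def sigma_algebra.sigma_sets_eq[OF sigma_algebra_Pow])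
  show "Int_stable (Pow (forecast_grid N))"
    by (auto simp: Int_stable_def)
  show "prob_space (crossing_distribution N (w z))" if "z \<in> space M" for z
    using that assms by (intro prob_space_crossing_distribution) auto
  show "sets (crossing_distribution N (w z)) = sets (forecast_space N)" for z
    by (simp add: crossing_distribution_def forecast_space_def sets_point_measure)
  show "(\<lambda>z. emeasure (crossing_distribution N (w z)) A) \<in> borel_measurable M"
    if "A \<in> Pow (forecast_grid N)" for A
  proof -
    have "(\<lambda>z. \<Sum>u\<in>A. ennreal (crossing_weight N (w z) (crossing N (w z)) u)) \<in> borel_measurable M"
      by (intro borel_measurable_sum measurable_compose[OF weight measurable_ennreal])
    then show ?thesis
      using that by (simp add: crossing_distribution_def emeasure_point_measure_finite)
  qed
qed simp

lemma calibrating_learner_in_learners: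
  fixes H :: "('x::topological_space \<Rightarrow> real) set"
  assumes "1 \<le> N" and H: "finite H" "H \<noteq> {}"
    and meas: "H \<subseteq> borel_measurable (instance_space X)"
    and range: "H \<subseteq> X \<rightarrow> {0..1}"
  shows "calibrating_learner H N \<in> learners X N"
  unfolding learners_def
proof (intro CollectI allI)
  fix t
  have "(\<lambda>z. crossing_distribution N (bucket_forecast H t (fst z) (snd z))) \<in>
      transcript_space X N t \<Otimes>\<^sub>M instance_space X \<rightarrow>\<^sub>M prob_algebra (forecast_space N)"
  proof (rule measurable_crossing_distribution[OF \<open>1 \<le> N\<close>])
    show "bucket_forecast H t (fst z) (snd z) v \<in> {0..1}"
      if "z \<in> space (transcript_space X N t \<Otimes>\<^sub>M instance_space X)" for z v
      using that H subsetD[OF range] by (intro bucket_forecast_bounds) (auto simp: space_pair_measure Pi_iff)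
    show "(\<lambda>z. bucket_forecast H t (fst z) (snd z) v) \<in> borel_measurable (transcript_space X N t \<Otimes>\<^sub>M instance_space X)" for v
      by (rule measurable_bucket_forecast[OF meas order_refl measurable_fst measurable_snd borel_measurable_const])
  qed
  then show "(\<lambda>(\<omega>, x). calibrating_learner H N t \<omega> x) \<in>
      transcript_space X N t \<Otimes>\<^sub>M instance_space X \<rightarrow>\<^sub>M prob_algebra (forecast_space N)"
    by (simp add: calibrating_learner_def case_prod_beta')
qed

section \<open>Swap regret of the calibrating learner\<close>

definition rounding_loss :: "('x \<Rightarrow> real) set \<Rightarrow> nat \<Rightarrow> 'x transcript \<Rightarrow> 'x round \<Rightarrow> real" where
  "rounding_loss H t \<omega> = (\<lambda>(x, p, y). brier_loss p y - brier_loss (bucket_forecast H t \<omega> x p) y)"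

text \<open>In each round the bucket forecast is inserted between the issued forecast and the
  comparator. A swap function chooses one comparator per bucket, and each of the at most
  \<open>N + 1\<close> buckets has regret at most \<open>ln (card H)\<close> against any choice. The
  estimate is pathwise and uniform in \<open>\<phi>\<close>, hence survives the supremum.\<close>

lemma swap_regret_le_rounding_loss:
  fixes H :: "('x::topological_space \<Rightarrow> real) set"
  assumes H: "finite H" "H \<noteq> {}" and range: "H \<subseteq> X \<rightarrow> {0..1}"
    and \<omega>: "\<omega> \<in> space (transcript_space X N T)"
  shows "swap_regret brier_loss H N T \<omega> \<le>
    (real N + 1) * ln (card H) + (\<Sum>t<T. rounding_loss H t \<omega> (\<omega> t))"
  unfolding swap_regret_def
proof (rule cSUP_least)
  show "(forecast_grid N \<rightarrow>\<^sub>E H) \<noteq> {}"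
    using H by (simp add: PiE_eq_empty_iff)
  fix \<phi> assume \<phi>: "\<phi> \<in> forecast_grid N \<rightarrow>\<^sub>E H"
  have \<omega>': "\<omega> t \<in> space (round_space X N)" if "t < T" for t
    by (rule transcript_space_memD[OF \<omega> that])
  \<comment> \<open>Each round contributes to exactly one bucket, so summing over \<open>v\<close>
    recovers the round and the two sums can be exchanged.\<close>
  define d where "d v t = (case \<omega> t of (x, p, y) \<Rightarrow>
    if p = v then brier_loss (bucket_forecast H t \<omega> x v) y - brier_loss (\<phi> v x) y else 0)" for v t
  have "(\<Sum>t<T. case \<omega> t of (x, p, y) \<Rightarrow> brier_loss p y - brier_loss (\<phi> p x) y) =
    (\<Sum>t<T. rounding_loss H t \<omega> (\<omega> t) + (\<Sum>v\<in>forecast_grid N. d v t))"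
  proof (rule sum.cong[OF refl])
    fix t assume "t \<in> {..<T}"
    then have "t < T" by simp
    obtain x p y where r: "\<omega> t = (x, p, y)" by (cases "\<omega> t")
    have p: "p \<in> forecast_grid N" using \<omega>'[OF \<open>t < T\<close>] by (simp add: r space_round_space)
    show "(case \<omega> t of (x, p, y) \<Rightarrow> brier_loss p y - brier_loss (\<phi> p x) y) =
      rounding_loss H t \<omega> (\<omega> t) + (\<Sum>v\<in>forecast_grid N. d v t)"
      using p by (simp add: d_def r rounding_loss_def)
  qed
  also have "\<dots> = (\<Sum>t<T. rounding_loss H t \<omega> (\<omega> t)) + (\<Sum>v\<in>forecast_grid N. \<Sum>t<T. d v t)"
    by (subst sum.swap) (simp add: sum.distrib)
  also have "(\<Sum>v\<in>forecast_grid N. \<Sum>t<T. d v t) \<le> (\<Sum>v\<in>forecast_grid N. ln (card H))"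
    using \<phi> unfolding d_def by (intro sum_mono bucket_regret_le[where X = X and N = N])
      (use H range \<omega>' in auto)
  also have "\<dots> = real (card (forecast_grid N)) * ln (card H)"
    by simp
  also have "\<dots> \<le> (real N + 1) * ln (card H)"
  proof (rule mult_right_mono)
    show "real (card (forecast_grid N)) \<le> real N + 1"
      using card_forecast_grid_le[of N] by linarith
    have "1 \<le> card H" using H by (simp add: Suc_leI card_gt_0_iff)
    then show "0 \<le> ln (real (card H))" by simp
  qed
  finally show "(\<Sum>t<T. case \<omega> t of (x, p, y) \<Rightarrow> brier_loss p y - brier_loss (\<phi> p x) y) \<le>
    (real N + 1) * ln (card H) + (\<Sum>t<T. rounding_loss H t \<omega> (\<omega> t))"
    by simp
qed


lemma measurable_rounding_loss:
  assumes H: "H \<subseteq> borel_measurable (instance_space X)" and "t \<le> T"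
    and \<omega>: "\<omega> \<in> M \<rightarrow>\<^sub>M transcript_space X N T" and r: "r \<in> M \<rightarrow>\<^sub>M round_space X N"
  shows "(\<lambda>z. rounding_loss H t (\<omega> z) (r z)) \<in> borel_measurable M"
proof -
  have p: "(\<lambda>z. fst (snd (r z))) \<in> borel_measurable M"
    by (rule measurable_compose[OF measurable_compose[OF r measurable_round_forecast] borel_measurable_forecast_space])
  have y: "(\<lambda>z. snd (snd (r z))) \<in> borel_measurable M"
    by (rule measurable_compose[OF measurable_compose[OF r measurable_round_outcome] borel_measurable_outcome_space])
  note w = measurable_bucket_forecast[OF H \<open>t \<le> T\<close> \<omega> measurable_compose[OF r measurable_round_fst] p]
  show ?thesis
    unfolding rounding_loss_def case_prod_beta'
    by (intro borel_measurable_diff borel_measurable_brier_loss p y w)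
qed

lemma rounding_loss_bound:
  assumes "finite H" "H \<noteq> {}" and range: "H \<subseteq> X \<rightarrow> {0..1}"
    and r: "r \<in> space (round_space X N)"
  shows "\<bar>rounding_loss H t \<omega> r\<bar> \<le> 1/2"
proof -
  obtain x p y where r': "r = (x, p, y)" by (cases r)
  have xpy: "x \<in> X" "p \<in> {0..1}" "y \<in> {0, 1}"
    using r forecast_grid_bounds[of p N] by (auto simp: r' space_round_space)
  then have "bucket_forecast H t \<omega> x p \<in> {0..1}"
    using assms(1,2) subsetD[OF range] by (intro bucket_forecast_bounds) (auto simp: Pi_iff)
  with xpy show ?thesis
    using abs_brier_loss_diff_le by (simp add: rounding_loss_def r')
qed

lemma finite_swap_functions: "finite H \<Longrightarrow> finite (forecast_grid N \<rightarrow>\<^sub>E H)"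
  by (simp add: finite_PiE)

lemma measurable_swap_regret:
  assumes H: "finite H" and meas: "H \<subseteq> borel_measurable (instance_space X)"
  shows "swap_regret brier_loss H N T \<in> borel_measurable (transcript_space X N T)"
  unfolding swap_regret_def[abs_def]
proof (rule borel_measurable_cSUP)
  show "countable (forecast_grid N \<rightarrow>\<^sub>E H)"
    using finite_swap_functions[OF H] by (rule countable_finite)
  show "bdd_above ((\<lambda>\<phi>. \<Sum>t<T. case \<omega> t of (x, p, y) \<Rightarrow> brier_loss p y - brier_loss (\<phi> p x) y) `
      (forecast_grid N \<rightarrow>\<^sub>E H))" for \<omega>
    using finite_swap_functions[OF H] by (intro bdd_above_finite finite_imageI)
  fix \<phi> assume \<phi>: "\<phi> \<in> forecast_grid N \<rightarrow>\<^sub>E H"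
  show "(\<lambda>\<omega>. \<Sum>t<T. case \<omega> t of (x, p, y) \<Rightarrow> brier_loss p y - brier_loss (\<phi> p x) y)
      \<in> borel_measurable (transcript_space X N T)"
  proof (rule borel_measurable_sum)
    fix t assume "t \<in> {..<T}"
    then have r: "(\<lambda>\<omega>. \<omega> t) \<in> transcript_space X N T \<rightarrow>\<^sub>M round_space X N"
      by (intro measurable_transcript_component) simp
    \<comment> \<open>The comparator itself depends on the forecast; since there are finitely many
      forecasts, measurability is checked for each of them.\<close>
    have \<phi>x: "(\<lambda>r. \<phi> (fst (snd r)) (fst r)) \<in> borel_measurable (round_space X N)"
    proof (rule measurable_compose_countable'[where I = "forecast_grid N" and g = "\<lambda>r. fst (snd r)"])
      show "(\<lambda>r. \<phi> v (fst r)) \<in> borel_measurable (round_space X N)" if "v \<in> forecast_grid N" for v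
        using subsetD[OF meas] \<phi> that by (intro measurable_compose[OF measurable_round_fst]) auto
      show "(\<lambda>r. fst (snd r)) \<in> round_space X N \<rightarrow>\<^sub>M count_space (forecast_grid N)"
        using measurable_round_forecast by (simp add: forecast_space_def)
    qed (simp add: countable_finite)
    have p: "(\<lambda>r. fst (snd r)) \<in> borel_measurable (round_space X N)"
      by (rule measurable_compose[OF measurable_round_forecast borel_measurable_forecast_space])
    have y: "(\<lambda>r. snd (snd r)) \<in> borel_measurable (round_space X N)"
      by (rule measurable_compose[OF measurable_round_outcome borel_measurable_outcome_space])
    have "(\<lambda>r. case r of (x, p, y) \<Rightarrow> brier_loss p y - brier_loss (\<phi> p x) y) \<in> borel_measurable (round_space X N)"
      unfolding case_prod_beta' by (intro borel_measurable_diff borel_measurable_brier_loss p y \<phi>x)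
    from measurable_compose[OF r this]
    show "(\<lambda>\<omega>. case \<omega> t of (x, p, y) \<Rightarrow> brier_loss p y - brier_loss (\<phi> p x) y)
      \<in> borel_measurable (transcript_space X N T)" .
  qed
qed

lemma swap_regret_bound:
  assumes H: "finite H" "H \<noteq> {}" and range: "H \<subseteq> X \<rightarrow> {0..1}"
    and \<omega>: "\<omega> \<in> space (transcript_space X N T)"
  shows "\<bar>swap_regret brier_loss H N T \<omega>\<bar> \<le> real T / 2"
proof -
  define R where "R \<phi> = (\<Sum>t<T. case \<omega> t of (x, p, y) \<Rightarrow> brier_loss p y - brier_loss (\<phi> p x) y)" for \<phi>
  let ?\<Phi> = "forecast_grid N \<rightarrow>\<^sub>E H"
  have bound: "\<bar>R \<phi>\<bar> \<le> real T / 2" if \<phi>: "\<phi> \<in> ?\<Phi>" for \<phi>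
  proof -
    have "\<bar>R \<phi>\<bar> \<le> (\<Sum>t<T. \<bar>case \<omega> t of (x, p, y) \<Rightarrow> brier_loss p y - brier_loss (\<phi> p x) y\<bar>)"
      unfolding R_def by (rule sum_abs)
    also have "\<dots> \<le> (\<Sum>t<T. 1/2)"
    proof (rule sum_mono)
      fix t assume "t \<in> {..<T}"
      obtain x p y where r: "\<omega> t = (x, p, y)" by (cases "\<omega> t")
      then have "x \<in> X" "p \<in> forecast_grid N" "y \<in> {0, 1}"
        using transcript_space_memD[OF \<omega>, of t] \<open>t \<in> {..<T}\<close> by (auto simp: space_round_space)
      moreover from this have "p \<in> {0..1}" "\<phi> p x \<in> {0..1}"
        using forecast_grid_bounds[of p N] subsetD[OF range, of "\<phi> p"] \<phi> by (auto simp: Pi_iff)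
      ultimately show "\<bar>case \<omega> t of (x, p, y) \<Rightarrow> brier_loss p y - brier_loss (\<phi> p x) y\<bar> \<le> 1/2"
        using abs_brier_loss_diff_le by (simp add: r)
    qed
    finally show ?thesis by simp
  qed
  obtain \<phi> where \<phi>: "\<phi> \<in> ?\<Phi>" using H by (metis PiE_eq_empty_iff ex_in_conv)
  have "(SUP \<phi>\<in>?\<Phi>. R \<phi>) \<le> real T / 2"
    by (rule cSUP_least) (use \<phi> in blast, rule order_trans[OF abs_ge_self bound])
  moreover have "- (real T / 2) \<le> (SUP \<phi>\<in>?\<Phi>. R \<phi>)"
    using \<phi> bound[OF \<phi>] finite_swap_functions[OF H(1), of N]
    by (intro cSUP_upper2[where x = \<phi>] bdd_above_finite finite_imageI) auto
  ultimately show ?thesis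
    unfolding swap_regret_def R_def[symmetric] by simp
qed

lemma (in forecasting_play) integrable_swap_regret:
  assumes "finite H" "H \<noteq> {}"
    and "H \<subseteq> borel_measurable (instance_space X)"
    and "H \<subseteq> X \<rightarrow> {0..1}"
  shows "integrable (play T) (swap_regret brier_loss H N T)"
  using assms by (intro integrable_play[OF measurable_swap_regret swap_regret_bound]) auto

text \<open>The bucket regrets are bounded pathwise, so only the accumulated rounding loss needs an
  expectation. Its conditional increment is at most \<open>1 / (8 * (real N)\<^sup>2)\<close> by the
  crossing estimate.\<close>

theorem calibrating_learner_regret_le:
  fixes H :: "('x::topological_space \<Rightarrow> real) set"
  assumes N: "1 \<le> N" and H: "finite H" "H \<noteq> {}"
    and meas: "H \<subseteq> borel_measurable (instance_space X)"
    and range: "H \<subseteq> X \<rightarrow> {0..1}"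
    and E: "E \<in> environments X N"
  shows "expected_swap_regret brier_loss X H N T (calibrating_learner H N) E \<le>
    (real N + 1) * ln (card H) + real T / (8 * (real N)\<^sup>2)"
proof -
  define L :: "'x learner" where "L = calibrating_learner H N"
  interpret forecasting_play X N L E
    using calibrating_learner_in_learners[OF N H meas range] E by unfold_locales (simp_all add: L_def)
  define f where "f t \<omega> = (\<Sum>i<t. rounding_loss H i \<omega> (\<omega> i))" for t and \<omega> :: "'x transcript"
  have f_meas: "f t \<in> borel_measurable (transcript_space X N t)" for t
    unfolding f_def
    by (intro borel_measurable_sum
        measurable_rounding_loss[OF meas _ measurable_ident_sets[OF refl] measurable_transcript_component]) auto
  have f_bound: "\<bar>f t \<omega>\<bar> \<le> real t / 2" if "\<omega> \<in> space (transcript_space X N t)" for t \<omega>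
  proof -
    have "\<bar>f t \<omega>\<bar> \<le> (\<Sum>i<t. \<bar>rounding_loss H i \<omega> (\<omega> i)\<bar>)"
      unfolding f_def by (rule sum_abs)
    also have "\<dots> \<le> (\<Sum>i<t. 1/2)"
      using transcript_space_memD[OF that] by (intro sum_mono rounding_loss_bound[OF H range]) auto
    finally show ?thesis by simp
  qed
  have "integral\<^sup>L (play T) (f T) \<le> f 0 (\<lambda>_. undefined) + real T * (1 / (8 * (real N)\<^sup>2))"
  proof (rule integral_play_le_drift)
    show "f t \<in> borel_measurable (transcript_space X N t)" for t by (fact f_meas)
    show "\<exists>B. \<forall>\<omega>\<in>space (transcript_space X N t). \<bar>f t \<omega>\<bar> \<le> B" for t
      using f_bound by blast
    fix t \<omega> assume \<omega>: "\<omega> \<in> space (transcript_space X N t)"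
    interpret \<kappa>: prob_space "round_kernel X N L E t \<omega>" by (rule prob_space_round_kernel[OF \<omega>])
    interpret A: prob_space "fst E t \<omega>" by (rule prob_space_instance[OF \<omega>])
    have rl_meas: "rounding_loss H t \<omega> \<in> borel_measurable (round_space X N)"
      using measurable_rounding_loss[OF meas order_refl measurable_const[OF \<omega>] measurable_ident] by simp
    note rl_bound = rounding_loss_bound[OF H range, where t = t and \<omega> = \<omega>]
    \<comment> \<open>The bucket forecast of round \<open>i\<close> reads only rounds before
      \<open>i\<close>, so writing round \<open>t\<close> leaves the terms up to \<open>t\<close>
      with the same forecasts.\<close>
    have upd: "f (Suc t) (fun_upd \<omega> t r) = f t \<omega> + rounding_loss H t \<omega> r" for r
    proof -
      have cong: "rounding_loss H i (fun_upd \<omega> t r) = rounding_loss H i \<omega>" if "i \<le> t" for i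
        unfolding rounding_loss_def
        using that bucket_forecast_cong[of i "fun_upd \<omega> t r" \<omega> H] by simp
      show ?thesis by (simp add: f_def cong)
    qed
    have inner: "(\<integral>p. (\<integral>y. rounding_loss H t \<omega> (x, p, y) \<partial>snd E t \<omega> x (L t \<omega> x)) \<partial>L t \<omega> x)
      \<le> 1 / (8 * (real N)\<^sup>2)" if x: "x \<in> X" for x
    proof -
      define \<nu> where "\<nu> = snd E t \<omega> x (L t \<omega> x)"
      interpret \<nu>: prob_space \<nu>
        unfolding \<nu>_def by (rule prob_space_outcome[OF \<omega> x])
      have \<nu>_sets: "sets \<nu> = sets outcome_space"
        unfolding \<nu>_def by (rule prob_space_outcome[OF \<omega> x])
      define w where "w = bucket_forecast H t \<omega> x"
      define i where "i = crossing N w"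
      define \<theta> where "\<theta> = crossing_prob N w i"
      have w: "w v \<in> {0..1}" for v
        unfolding w_def using H subsetD[OF range] x by (intro bucket_forecast_bounds) (auto simp: Pi_iff)
      note cr = crossing[where N = N and w = w, OF N w, folded i_def]
      have grid: "real i / real N \<in> forecast_grid N" "real (Suc i) / real N \<in> forecast_grid N"
        using cr(1) unfolding forecast_grid_def by (auto intro: exI[of _ i] exI[of _ "Suc i"] simp del: of_nat_Suc)
      have int: "integrable \<nu> (\<lambda>y. rounding_loss H t \<omega> (x, p, y))" if "p \<in> forecast_grid N" for p
      proof (rule \<nu>.integrable_const_bound[where B = "1/2"])
        show "AE y in \<nu>. norm (rounding_loss H t \<omega> (x, p, y)) \<le> 1/2"
          using rl_bound[of "(x, p, _)"] x that sets_eq_imp_space_eq[OF \<nu>_sets]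
          by (intro AE_I2) (simp add: space_round_space)
        show "(\<lambda>y. rounding_loss H t \<omega> (x, p, y)) \<in> borel_measurable \<nu>"
          using borel_measurable_outcome_space by (simp only: measurable_cong_sets[OF \<nu>_sets refl])
      qed
      have "(\<integral>p. (\<integral>y. rounding_loss H t \<omega> (x, p, y) \<partial>\<nu>) \<partial>L t \<omega> x) =
        (1 - \<theta>) * (\<integral>y. rounding_loss H t \<omega> (x, real i / real N, y) \<partial>\<nu>) +
        \<theta> * (\<integral>y. rounding_loss H t \<omega> (x, real (Suc i) / real N, y) \<partial>\<nu>)"
        unfolding L_def calibrating_learner_def w_def[symmetric] \<theta>_def i_def
        by (rule integral_crossing_distribution[where N = N and w = w, OF N w])
      \<comment> \<open>Here nonanticipation enters: both candidate forecasts face the same outcome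
        law \<open>\<nu>\<close>, so the mixture can be formed under the integral and bounded for
        each \<open>y\<close> separately.\<close>
      also have "\<dots> = (\<integral>y. (1 - \<theta>) * rounding_loss H t \<omega> (x, real i / real N, y) +
        \<theta> * rounding_loss H t \<omega> (x, real (Suc i) / real N, y) \<partial>\<nu>)"
        using int[OF grid(1)] int[OF grid(2)] by simp
      also have "\<dots> \<le> 1 / (8 * (real N)\<^sup>2)"
      proof (rule \<nu>.integral_le_nonneg_const)
        fix y
        define a where "a = w (real i / real N) - real i / real N"
        define b where "b = real (Suc i) / real N - w (real (Suc i) / real N)"
        have ab: "real i / real N + a = w (real i / real N)" "real (Suc i) / real N - b = w (real (Suc i) / real N)"
          by (simp_all add: a_def b_def)
        have \<theta>: "a / (a + b) = \<theta>"
          by (simp add: \<theta>_def crossing_prob_def a_def b_def)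
        have gap: "real (Suc i) / real N - real i / real N = 1 / real N"
          by (simp add: diff_divide_distrib[symmetric])
        have "0 \<le> a" "0 \<le> b" using cr(2,3) by (simp_all add: a_def b_def)
        from crossing_loss_le[OF this, of "real i / real N" y "real (Suc i) / real N", unfolded ab \<theta> gap]
        show "(1 - \<theta>) * rounding_loss H t \<omega> (x, real i / real N, y) +
            \<theta> * rounding_loss H t \<omega> (x, real (Suc i) / real N, y) \<le> 1 / (8 * (real N)\<^sup>2)"
          by (simp add: rounding_loss_def w_def[symmetric] power_divide mult.commute del: of_nat_Suc)
      qed simp
      finally show ?thesis by (simp add: \<nu>_def)
    qed
    have "(\<integral>r. f (Suc t) (fun_upd \<omega> t r) \<partial>round_kernel X N L E t \<omega>) =
        f t \<omega> + (\<integral>r. rounding_loss H t \<omega> r \<partial>round_kernel X N L E t \<omega>)"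
      unfolding upd
      using integrable_round_kernel[OF \<omega> rl_meas rl_bound] \<kappa>.prob_space by simp
    also have "(\<integral>r. rounding_loss H t \<omega> r \<partial>round_kernel X N L E t \<omega>) \<le> 1 / (8 * (real N)\<^sup>2)"
      by (subst integral_round_kernel[OF \<omega> rl_meas rl_bound], assumption, rule A.integral_le_nonneg_const)
        (use inner prob_space_instance(2)[OF \<omega>] in auto)
    finally show "(\<integral>r. f (Suc t) (fun_upd \<omega> t r) \<partial>round_kernel X N L E t \<omega>) \<le> f t \<omega> + 1 / (8 * (real N)\<^sup>2)"
      by simp
  qed
  moreover have "f 0 (\<lambda>_. undefined) = 0" by (simp add: f_def)
  moreover have "expected_swap_regret brier_loss X H N T L E \<le>
      (real N + 1) * ln (card H) + integral\<^sup>L (play T) (f T)"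
  proof -
    interpret P: prob_space "play T" by (rule prob_space_play)
    have int: "integrable (play T) (f T)"
      by (rule integrable_play[OF f_meas f_bound])
    have le: "swap_regret brier_loss H N T \<omega> \<le> (real N + 1) * ln (card H) + f T \<omega>"
      if "\<omega> \<in> space (play T)" for \<omega>
      unfolding f_def using that by (intro swap_regret_le_rounding_loss[OF H range]) simp_all
    have "expected_swap_regret brier_loss X H N T L E
        \<le> (\<integral>\<omega>. (real N + 1) * ln (card H) + f T \<omega> \<partial>play T)"
      unfolding expected_swap_regret_def
      by (rule integral_mono[OF integrable_swap_regret[OF H meas range] _ le])
        (use int in simp_all)
    also have "\<dots> = (real N + 1) * ln (card H) + integral\<^sup>L (play T) (f T)"
      using int P.prob_space by (simp del: space_play)
    finally show ?thesis .
  qed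
  ultimately show ?thesis by (simp add: L_def)
qed

section \<open>The cycling environment\<close>

definition bernoulli_outcome :: "real \<Rightarrow> real measure" where
  "bernoulli_outcome q = point_measure {0, 1} (\<lambda>y. if y = 1 then q else 1 - q)"

lemma bernoulli_outcome_in_prob_algebra:
  assumes "q \<in> {0..1}"
  shows "bernoulli_outcome q \<in> space (prob_algebra outcome_space)"
proof -
  have "prob_space (bernoulli_outcome q)"
    using assms
    by (intro prob_spaceI) (simp add: bernoulli_outcome_def space_point_measure
        emeasure_point_measure_finite ennreal_plus[symmetric] del: ennreal_plus)
  then show ?thesis
    by (simp add: space_prob_algebra bernoulli_outcome_def outcome_space_def sets_point_measure)
qed

lemma integral_bernoulli_outcome:
  fixes f :: "real \<Rightarrow> real"
  assumes "q \<in> {0..1}"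
  shows "integral\<^sup>L (bernoulli_outcome q) f = q * f 1 + (1 - q) * f 0"
  unfolding bernoulli_outcome_def using assms
  by (subst lebesgue_integral_point_measure_finite) auto

section \<open>Polynomial bounds for the modulus\<close>

lemma abs_ge_quartic:
  fixes w r :: real
  assumes "0 < r"
  shows "w\<^sup>2 / r - w ^ 4 / (4 * r ^ 3) \<le> \<bar>w\<bar>"
proof -
  define u where "u = \<bar>w\<bar> / r"
  have u: "0 \<le> u" using assms by (simp add: u_def)
  \<comment> \<open>A certificate that \<open>u + u ^ 4 / 4 - u\<^sup>2\<close> is nonnegative for
    \<open>u \<ge> 0\<close>: the first term supplies the quartic, and the second cancels its cubic
    term.\<close>
  have "0 \<le> u\<^sup>2 * (u - 1)\<^sup>2 / 4 + u * ((u - 5/4)\<^sup>2 / 2 + 7/32)"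
    using u by simp
  also have "\<dots> = u + u ^ 4 / 4 - u\<^sup>2"
    by (simp add: field_simps power2_eq_square power4_eq_xxxx)
  finally have "u\<^sup>2 - u ^ 4 / 4 \<le> u" by simp
  then have "r * (u\<^sup>2 - u ^ 4 / 4) \<le> r * u"
    using assms by (intro mult_left_mono) auto
  moreover have "r * u = \<bar>w\<bar>" using assms by (simp add: u_def)
  moreover have "r * (u\<^sup>2 - u ^ 4 / 4) = w\<^sup>2 / r - w ^ 4 / (4 * r ^ 3)"
    using assms by (simp add: u_def power_divide power2_eq_square power3_eq_cube power4_eq_xxxx field_simps)
  ultimately show ?thesis by simp
qed

text \<open>The difference of the two sides is a square divided by \<open>4 * a\<close>. This trades
  the modulus of a discrepancy for its square, whose conditional expectation is explicit.\<close>

lemma abs_le_quadratic: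
  fixes d a :: real
  assumes "0 < a"
  shows "\<bar>d\<bar> \<le> a * d\<^sup>2 + 1 / (4 * a)"
proof -
  have "0 \<le> (2 * a * \<bar>d\<bar> - 1)\<^sup>2 / (4 * a)" using assms by simp
  also have "\<dots> = a * d\<^sup>2 + 1 / (4 * a) - \<bar>d\<bar>"
    using assms by (simp add: power2_eq_square field_simps)
  finally show ?thesis by simp
qed

text \<open>For \<open>m = 0\<close> this is the lower bound of the modulus in
  \<open>abs_ge_quartic\<close>. Being polynomial in \<open>w\<close>, it has a conditional
  expectation that can be computed from the moments of one step.\<close>

definition walk_potential :: "real \<Rightarrow> real \<Rightarrow> real \<Rightarrow> real" where
  "walk_potential r m w = w\<^sup>2 / r - (w ^ 4 + 7/4 * m * w\<^sup>2) / (4 * r ^ 3)"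

text \<open>
  The compensator \<open>7/4 * m * w\<^sup>2\<close>, with \<open>m\<close> the number of steps still to come, makes the
  drift lower bound independent of the position \<open>w\<close> of the walk.
\<close>

lemma walk_potential_drift:
  fixes q r m w :: real
  assumes q: "1/4 \<le> q" "q \<le> 3/4" and r: "0 < r" and m: "1 \<le> m"
  shows "walk_potential r m w + 3 / (16 * r) - m / (4 * r ^ 3) \<le>
    q * walk_potential r (m - 1) (w + (1 - q)) + (1 - q) * walk_potential r (m - 1) (w + (0 - q))"
proof -
  \<comment> \<open>The variance of one step; keeping \<open>q\<close> between 1/4 and 3/4 keeps it
    at least 3/16.\<close>
  define v where "v = q * (1 - q)"
  have v: "3/16 \<le> v" "v \<le> 1/4"
  proof -
    have "v - 3/16 = (q - 1/4) * (3/4 - q)" unfolding v_def by (simp add: field_simps power2_eq_square power4_eq_xxxx)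
    also have "0 \<le> \<dots>" using q by simp
    finally show "3/16 \<le> v" by simp
    have "1/4 - v = (q - 1/2)\<^sup>2" unfolding v_def by (simp add: field_simps power2_eq_square power4_eq_xxxx)
    also have "0 \<le> \<dots>" by simp
    finally show "v \<le> 1/4" by simp
  qed
  \<comment> \<open>The expected increment of the subtracted quartic part. The factors
    \<open>v\<close>, \<open>v * (1 - 2 * q)\<close> and \<open>v * (1 - 3 * v)\<close> are the
    second, third and fourth central moments of a Bernoulli variable.\<close>
  define c where "c = 6 * w\<^sup>2 * v + 4 * w * (v * (1 - 2 * q)) + v * (1 - 3 * v) + 7/4 * (m - 1) * v - 7/4 * w\<^sup>2"
  have eq: "q * walk_potential r (m - 1) (w + (1 - q)) + (1 - q) * walk_potential r (m - 1) (w + (0 - q))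
      = walk_potential r m w + v / r - c / (4 * r ^ 3)"
  proof -
    have 2: "q * (w + (1 - q))\<^sup>2 + (1 - q) * (w + (0 - q))\<^sup>2 = w\<^sup>2 + v"
      unfolding v_def by (simp add: field_simps power2_eq_square power4_eq_xxxx)
    have 4: "q * ((w + (1 - q)) ^ 4 + 7/4 * (m - 1) * (w + (1 - q))\<^sup>2) +
        (1 - q) * ((w + (0 - q)) ^ 4 + 7/4 * (m - 1) * (w + (0 - q))\<^sup>2) = w ^ 4 + 7/4 * m * w\<^sup>2 + c"
      unfolding c_def v_def by (simp add: field_simps power2_eq_square power4_eq_xxxx)
    have lin: "q * (A / r - B / R) + (1 - q) * (A' / r - B' / R) =
        (q * A + (1 - q) * A') / r - (q * B + (1 - q) * B') / R" for A A' B B' R :: real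
      by (simp add: divide_inverse algebra_simps)
    have "q * walk_potential r (m - 1) (w + (1 - q)) + (1 - q) * walk_potential r (m - 1) (w + (0 - q)) =
      (q * (w + (1 - q))\<^sup>2 + (1 - q) * (w + (0 - q))\<^sup>2) / r -
      (q * ((w + (1 - q)) ^ 4 + 7/4 * (m - 1) * (w + (1 - q))\<^sup>2) +
        (1 - q) * ((w + (0 - q)) ^ 4 + 7/4 * (m - 1) * (w + (0 - q))\<^sup>2)) / (4 * r ^ 3)"
      unfolding walk_potential_def by (rule lin)
    then show ?thesis
      unfolding 2 4 by (simp add: walk_potential_def add_divide_distrib)
  qed
  \<comment> \<open>The constant 7/4 arises here: the quadratic term contributes at most 3/2 of the
    square of \<open>w\<close> and the skewness term at most 1/4 of it, so the compensator cancels
    them exactly. What is left is at most \<open>m\<close> because \<open>m \<ge> 1\<close>.\<close>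
  have "c \<le> m"
  proof -
    have 1: "6 * w\<^sup>2 * v \<le> 3/2 * w\<^sup>2"
      using mult_left_mono[OF v(2), of "6 * w\<^sup>2"] by simp
    have "\<bar>v * (1 - 2 * q)\<bar> \<le> 1/4 * (1/2)"
      unfolding abs_mult
    proof (rule mult_mono)
      show "\<bar>1 - 2 * q\<bar> \<le> 1/2" using q by linarith
    qed (use v in auto)
    then have "\<bar>w\<bar> * \<bar>v * (1 - 2 * q)\<bar> \<le> \<bar>w\<bar> * (1/8)"
      by (intro mult_left_mono) auto
    then have "4 * w * (v * (1 - 2 * q)) \<le> \<bar>w\<bar> / 2"
      using abs_ge_self[of "w * (v * (1 - 2 * q))"] by (simp add: abs_mult)
    moreover have "\<bar>w\<bar> / 2 \<le> w\<^sup>2 / 4 + 1/4"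
      using zero_le_power2[of "\<bar>w\<bar> - 1"] by (simp add: power2_diff)
    ultimately have 2: "4 * w * (v * (1 - 2 * q)) \<le> w\<^sup>2 / 4 + 1/4" by simp
    have 3: "v * (1 - 3 * v) \<le> 1/4 * 1"
      using v by (intro mult_mono) auto
    have 4: "7/4 * (m - 1) * v \<le> 7/4 * (m - 1) * (1/4)"
      using m v by (intro mult_left_mono) auto
    have "A + B + C + D - 7/4 * z \<le> m"
      if "A \<le> 3/2 * z" "B \<le> z / 4 + 1/4" "C \<le> 1/4 * 1" "D \<le> 7/4 * (m - 1) * (1/4)" for A B C D z :: real
      using that m by simp
    from this[OF 1 2 3 4] show ?thesis unfolding c_def .
  qed
  then have "c / (4 * r ^ 3) \<le> m / (4 * r ^ 3)"
    using r by (intro divide_right_mono) auto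
  moreover have "3 / (16 * r) \<le> v / r"
    using divide_right_mono[OF v(1), of r] r by simp
  ultimately show ?thesis unfolding eq by simp
qed

section \<open>Cells of the target interval\<close>

definition cell :: "nat \<Rightarrow> real \<Rightarrow> int" where
  "cell K p = \<lfloor>(p - 1/4) * (2 * real K)\<rfloor>"

definition cell_center :: "nat \<Rightarrow> nat \<Rightarrow> real" where
  "cell_center K j = 1/4 + (real j + 1/2) / (2 * real K)"

lemma cell_center_bounds:
  assumes "j < K" shows "1/4 \<le> cell_center K j" "cell_center K j \<le> 3/4"
proof -
  have "(real j + 1/2) / (2 * real K) \<le> real K / (2 * real K)"
    using assms by (intro divide_right_mono) auto
  also have "\<dots> = 1/2" using assms by simp
  finally have "1/4 + (real j + 1/2) / (2 * real K) \<le> 1/4 + 1/2" by (rule add_left_mono)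
  then show "cell_center K j \<le> 3/4" unfolding cell_center_def by simp
qed (simp add: cell_center_def)

text \<open>Cells have width \<open>1 / (2 * real K)\<close>, so leaving one costs at least half of
  it in distance from the center. Since \<open>cell\<close> takes integer values, forecasts below
  1/4 or from 3/4 upwards also count as stray: their index lies outside
  \<open>0..K-1\<close>.\<close>

lemma dist_cell_center_ge:
  assumes K: "0 < K" and "cell K p \<noteq> int j"
  shows "1 / (16 * (real K)\<^sup>2) \<le> (p - cell_center K j)\<^sup>2"
proof -
  have "\<not> \<bar>p - cell_center K j\<bar> < 1 / (4 * real K)"
  proof
    assume "\<bar>p - cell_center K j\<bar> < 1 / (4 * real K)"
    then have "\<bar>p - cell_center K j\<bar> * (2 * real K) < 1 / (4 * real K) * (2 * real K)"
      using K by (intro mult_strict_right_mono) auto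
    then have "\<bar>(p - cell_center K j) * (2 * real K)\<bar> < 1/2"
      using K by (simp add: abs_mult)
    moreover have "(p - cell_center K j) * (2 * real K) = (p - 1/4) * (2 * real K) - (real j + 1/2)"
      using K by (simp add: cell_center_def field_simps)
    ultimately have "\<lfloor>(p - 1/4) * (2 * real K)\<rfloor> = int j"
      by (intro floor_unique) (simp_all only: of_int_of_nat_eq abs_less_iff, linarith+)
    then show False using assms by (simp add: cell_def)
  qed
  then have "(1 / (4 * real K))\<^sup>2 \<le> \<bar>p - cell_center K j\<bar>\<^sup>2"
    by (intro power_mono) auto
  then show ?thesis by (simp add: power_divide power_mult_distrib)
qed

text \<open>Division by \<open>K\<close> is injective on a residue class and maps it into
  \<open>{..T div K}\<close>. The bound limits the number of visits to one target.\<close>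

lemma card_residue_class_le:
  assumes "0 < K" shows "card {i. i < T \<and> i mod K = j} \<le> T div K + 1"
proof -
  have "inj_on (\<lambda>i. i div K) {i. i < T \<and> i mod K = j}"
    by (rule inj_onI) (metis (mono_tags, lifting) div_mult_mod_eq mem_Collect_eq)
  moreover have "(\<lambda>i. i div K) ` {i. i < T \<and> i mod K = j} \<subseteq> {..T div K}"
    by (auto intro: div_le_mono)
  ultimately have "card {i. i < T \<and> i mod K = j} \<le> card {..T div K}"
    by (intro card_inj_on_le) auto
  then show ?thesis by simp
qed

text \<open>The environment is determined by the number \<open>K\<close> of targets and the shift
  \<open>s\<close>. The parameters of the potential are \<open>r\<close>, the scale on which the
  walks are measured, and \<open>n\<close>, later assumed to dominate the number of visits to any
  target.\<close>

locale cycling_environment =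
  fixes K :: nat and s r n :: real
  assumes K: "0 < K" and s: "0 < s" "s \<le> 1/8" and r: "0 < r"
begin

definition target :: "nat \<Rightarrow> real" where "target t = cell_center K (t mod K)"

definition env :: "(real \<times> real) instance_strategy \<times> (real \<times> real) outcome_strategy" where
  "env = (\<lambda>t h. return (instance_space X_star) (target t, s), \<lambda>t h x \<psi>. bernoulli_outcome (target t))"

definition noise :: "(real \<times> real) transcript \<Rightarrow> nat \<Rightarrow> real" where
  "noise h i = snd (snd (h i)) - target i"

definition visits :: "nat \<Rightarrow> nat \<Rightarrow> real" where
  "visits t j = (\<Sum>i<t. of_bool (i mod K = j))"

definition walk :: "nat \<Rightarrow> (real \<times> real) transcript \<Rightarrow> nat \<Rightarrow> real" where
  "walk t h j = (\<Sum>i<t. of_bool (i mod K = j) * noise h i)"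

text \<open>Noise sorted by the cell of the forecast minus noise sorted by target. A swap function
  sees only the former sorting, whereas \<open>walk\<close>, the latter, is beyond the learner's
  control.\<close>

definition discrepancy :: "nat \<Rightarrow> (real \<times> real) transcript \<Rightarrow> nat \<Rightarrow> real" where
  "discrepancy t h j =
    (\<Sum>i<t. (of_bool (cell K (fst (snd (h i))) = int j) - of_bool (i mod K = j)) * noise h i)"

text \<open>The Brier regret against the constant prediction \<open>target i\<close>, less the price
  \<open>s\<^sup>2 / 2\<close> of a shift by \<open>s\<close> in either direction.\<close>

definition regret_to_target :: "(real \<times> real) transcript \<Rightarrow> nat \<Rightarrow> real" where
  "regret_to_target h i = (fst (snd (h i)) - target i)\<^sup>2 / 2 - (fst (snd (h i)) - target i) * noise h i - s\<^sup>2 / 2"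

text \<open>Chosen so that the expected growth of the discrepancy penalty in a stray round, at most
  \<open>s * scale / 2\<close>, equals the least cost \<open>1 / (32 * (real K)\<^sup>2)\<close> of
  leaving the cell.\<close>

definition scale :: real where "scale = 1 / (16 * (real K)\<^sup>2 * s)"

text \<open>The bracket is designed to lie below the modulus of \<open>walk + discrepancy\<close> in
  each cell: \<open>walk_potential\<close> is the polynomial substitute for the modulus of the walk,
  and the last two terms dominate the modulus of the discrepancy.\<close>

definition potential :: "nat \<Rightarrow> (real \<times> real) transcript \<Rightarrow> real" where
  "potential t h = (\<Sum>i<t. regret_to_target h i) +
    s * (\<Sum>j<K. walk_potential r (n - visits t j) (walk t h j)
      - scale * (discrepancy t h j)\<^sup>2 - 1 / (4 * scale))"

lemma scale_pos: "0 < scale"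
  using K s by (simp add: scale_def)

lemma target_bounds: "1/4 \<le> target t" "target t \<le> 3/4"
  using cell_center_bounds[of "t mod K" K] K by (simp_all add: target_def)

lemma target_mem: "(target t, s) \<in> X_star"
  using target_bounds[of t] s by (simp add: X_star_def)

lemma env_in_environments: "env \<in> environments X_star N"
proof -
  have "return (instance_space X_star) (target t, s) \<in> space (prob_algebra (instance_space X_star))" for t
    using target_mem by (simp add: space_prob_algebra prob_space_return)
  moreover have "bernoulli_outcome (target t) \<in> space (prob_algebra outcome_space)" for t
    using target_bounds[of t] by (intro bernoulli_outcome_in_prob_algebra) simp
  ultimately show ?thesis
    by (simp add: env_def environments_def instance_strategies_def outcome_strategies_def case_prod_beta')
qed

lemma potential_0: "potential 0 h = - (4 * s\<^sup>2 * real K ^ 3)"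
proof -
  have "s * (real K / (4 * scale)) = 4 * s\<^sup>2 * real K ^ 3"
    using K s by (simp add: scale_def power2_eq_square power3_eq_cube)
  then show ?thesis
    by (simp add: potential_def walk_def discrepancy_def walk_potential_def)
qed

lemma potential_Suc_upd:
  "potential (Suc t) (h(t := (x, p, y))) =
    (\<Sum>i<t. regret_to_target h i) +
    ((p - target t)\<^sup>2 / 2 - (p - target t) * (y - target t) - s\<^sup>2 / 2) +
    s * (\<Sum>j<K. walk_potential r (n - visits t j - of_bool (t mod K = j))
          (walk t h j + of_bool (t mod K = j) * (y - target t))
      - scale * (discrepancy t h j +
          (of_bool (cell K p = int j) - of_bool (t mod K = j)) * (y - target t))\<^sup>2 - 1 / (4 * scale))"
proof -
  have "(\<Sum>i<t. regret_to_target (h(t := (x, p, y))) i) = (\<Sum>i<t. regret_to_target h i)"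
    by (rule sum.cong) (auto simp: regret_to_target_def noise_def)
  moreover have "walk t (h(t := (x, p, y))) j = walk t h j" for j
    unfolding walk_def by (rule sum.cong) (auto simp: noise_def)
  moreover have "discrepancy t (h(t := (x, p, y))) j = discrepancy t h j" for j
    unfolding discrepancy_def by (rule sum.cong) (auto simp: noise_def)
  moreover have "walk (Suc t) h' j = walk t h' j + of_bool (t mod K = j) * noise h' t"
    "discrepancy (Suc t) h' j = discrepancy t h' j +
      (of_bool (cell K (fst (snd (h' t))) = int j) - of_bool (t mod K = j)) * noise h' t"
    "visits (Suc t) j = visits t j + of_bool (t mod K = j)" for h' j
    by (simp_all add: walk_def discrepancy_def visits_def)
  ultimately show ?thesis
    by (simp add: potential_def regret_to_target_def noise_def diff_diff_eq)
qed

lemma visits_eq_card: "visits t j = real (card {i. i < t \<and> i mod K = j})"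
proof -
  have "{..<t} \<inter> {i. i mod K = j} = {i. i < t \<and> i mod K = j}" by auto
  then show ?thesis by (simp add: visits_def sum.If_cases of_bool_def)
qed

lemma visits_nonneg: "0 \<le> visits t j"
  by (simp add: visits_eq_card)

lemma visits_le:
  assumes "t \<le> T" "real (T div K) + 1 \<le> n"
  shows "visits t j \<le> n"
proof -
  have "card {i. i < t \<and> i mod K = j} \<le> t div K + 1"
    by (rule card_residue_class_le[OF K])
  also have "\<dots> \<le> T div K + 1" using assms by (simp add: div_le_mono)
  finally show ?thesis using assms(2) unfolding visits_eq_card by linarith
qed

definition drift :: real where
  "drift = s * (3 / (16 * r) - n / (4 * r ^ 3)) - s\<^sup>2 / 2"

text \<open>For any forecast, averaging over the outcome removes the terms linear in the noise. The
  walk of the current target gains, the other walks stand still, and the discrepancies grow only if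
  the forecast is stray, which its squared distance from the target pays for.\<close>

lemma potential_drift:
  assumes "t < T" "real (T div K) + 1 \<le> n"
  shows "potential t h + drift \<le>
    target t * potential (Suc t) (h(t := (x, p, 1))) + (1 - target t) * potential (Suc t) (h(t := (x, p, 0)))"
proof -
  define q where "q = target t"
  define \<delta> :: "nat \<Rightarrow> real" where "\<delta> j = of_bool (t mod K = j)" for j
  define c :: "nat \<Rightarrow> real" where "c j = of_bool (cell K p = int j) - \<delta> j" for j
  define W where "W j y = walk_potential r (n - visits t j - \<delta> j) (walk t h j + \<delta> j * (y - q))" for j y
  define D where "D j y = (discrepancy t h j + c j * (y - q))\<^sup>2" for j y
  define miss :: real where "miss = of_bool (cell K p \<noteq> int (t mod K))"
  note q = target_bounds[of t, folded q_def]
  have pot: "potential (Suc t) (h(t := (x, p, y))) = (\<Sum>i<t. regret_to_target h i) +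
    ((p - q)\<^sup>2 / 2 - (p - q) * (y - q) - s\<^sup>2 / 2) +
    s * ((\<Sum>j<K. W j y) - scale * (\<Sum>j<K. D j y) - real K / (4 * scale))" for y
    unfolding potential_Suc_upd q_def[symmetric] \<delta>_def[symmetric] c_def[symmetric] W_def[symmetric] D_def[symmetric]
    by (simp add: sum_subtractf sum_distrib_left)
  have W: "(\<Sum>j<K. walk_potential r (n - visits t j) (walk t h j)) + (3 / (16 * r) - n / (4 * r ^ 3))
    \<le> q * (\<Sum>j<K. W j 1) + (1 - q) * (\<Sum>j<K. W j 0)"
  proof -
    have "walk_potential r (n - visits t j) (walk t h j) + \<delta> j * (3 / (16 * r) - n / (4 * r ^ 3))
      \<le> q * W j 1 + (1 - q) * W j 0" for j
    proof (cases "t mod K = j")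
      case True
      then have \<delta>: "\<delta> j = 1" by (simp add: \<delta>_def)
      \<comment> \<open>The visit of the current round is counted too, which leaves at least one
        step before it, as the walk estimate requires.\<close>
      have "visits (Suc t) j \<le> n" using assms by (intro visits_le) auto
      then have m: "1 \<le> n - visits t j" using True by (simp add: visits_def)
      have "(n - visits t j) / (4 * r ^ 3) \<le> n / (4 * r ^ 3)"
        using r visits_nonneg[of t j] by (intro divide_right_mono) auto
      then show ?thesis
        using walk_potential_drift[OF q r m, of "walk t h j"] by (simp add: W_def \<delta>)
    next
      case False
      then show ?thesis by (simp add: W_def \<delta>_def left_diff_distrib)
    qed
    then have "(\<Sum>j<K. walk_potential r (n - visits t j) (walk t h j) + \<delta> j * (3 / (16 * r) - n / (4 * r ^ 3)))
      \<le> (\<Sum>j<K. q * W j 1 + (1 - q) * W j 0)"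
      by (intro sum_mono)
    moreover have "(\<Sum>j<K. \<delta> j) = 1" using K by (simp add: \<delta>_def of_bool_def)
    ultimately show ?thesis
      by (simp add: sum.distrib sum_distrib_left[symmetric] sum_distrib_right[symmetric])
  qed
  \<comment> \<open>The cross term vanishes because the noise is centered. A stray forecast alters
    at most two discrepancies, each by a step of variance at most 1/4.\<close>
  have D: "q * (\<Sum>j<K. D j 1) + (1 - q) * (\<Sum>j<K. D j 0) \<le> (\<Sum>j<K. (discrepancy t h j)\<^sup>2) + miss / 2"
  proof -
    have "q * D j 1 + (1 - q) * D j 0 \<le> (discrepancy t h j)\<^sup>2 + miss * (of_bool (cell K p = int j) + \<delta> j) / 4" for j
    proof -
      have "q * D j 1 + (1 - q) * D j 0 = (discrepancy t h j)\<^sup>2 + (c j)\<^sup>2 * (q * (1 - q))"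
        unfolding D_def by (simp add: field_simps power2_eq_square power4_eq_xxxx)
      also have "(c j)\<^sup>2 * (q * (1 - q)) \<le> (c j)\<^sup>2 * (1/4)"
        using zero_le_power2[of "q - 1/2"] by (intro mult_left_mono) (simp_all add: power2_eq_square algebra_simps)
      also have "(c j)\<^sup>2 \<le> miss * (of_bool (cell K p = int j) + \<delta> j)"
        by (auto simp: c_def miss_def \<delta>_def)
      finally show ?thesis by simp
    qed
    then have "(\<Sum>j<K. q * D j 1 + (1 - q) * D j 0) \<le>
      (\<Sum>j<K. (discrepancy t h j)\<^sup>2 + miss * (of_bool (cell K p = int j) + \<delta> j) / 4)"
      by (intro sum_mono)
    also have "\<dots> = (\<Sum>j<K. (discrepancy t h j)\<^sup>2) +
        miss * ((\<Sum>j<K. of_bool (cell K p = int j)) + (\<Sum>j<K. \<delta> j)) / 4"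
      by (simp only: sum.distrib sum_distrib_left[symmetric] sum_divide_distrib[symmetric])
    also have "\<dots> \<le> (\<Sum>j<K. (discrepancy t h j)\<^sup>2) + miss * (1 + 1) / 4"
    proof -
      have "(\<Sum>j<K. of_bool (cell K p = int j)) \<le> (1::real)"
      proof -
        have "(\<Sum>j<K. of_bool (cell K p = int j)) \<le> (\<Sum>j<K. of_bool (nat (cell K p) = j) :: real)"
          by (rule sum_mono) auto
        also have "\<dots> \<le> 1" by (simp add: of_bool_def)
        finally show ?thesis .
      qed
      moreover have "(\<Sum>j<K. \<delta> j) \<le> 1" by (simp add: \<delta>_def of_bool_def)
      ultimately show ?thesis
        by (intro add_left_mono divide_right_mono mult_left_mono add_mono) (auto simp: miss_def)
    qed
    finally show ?thesis by (simp add: sum.distrib sum_distrib_left)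
  qed
  \<comment> \<open>Names for terms that do not depend on the outcome, kept opaque in the final
    algebraic identity.\<close>
  define P where "P = (p - q)\<^sup>2 / 2"
  define S where "S = s\<^sup>2 / 2"
  define Q where "Q = real K / (4 * scale)"
  \<comment> \<open>This is the inequality for which \<open>scale\<close> was chosen.\<close>
  have miss: "s * scale * (miss / 2) \<le> (p - q)\<^sup>2 / 2"
    using dist_cell_center_ge[OF K, of p "t mod K"] s
    by (auto simp: miss_def scale_def q_def target_def)
  have "potential t h + drift = (\<Sum>i<t. regret_to_target h i) - s\<^sup>2 / 2 +
      s * ((\<Sum>j<K. walk_potential r (n - visits t j) (walk t h j)) + (3 / (16 * r) - n / (4 * r ^ 3))) -
      s * scale * (\<Sum>j<K. (discrepancy t h j)\<^sup>2) - s * (real K / (4 * scale))"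
  proof -
    have "(\<Sum>j<K. walk_potential r (n - visits t j) (walk t h j) - scale * (discrepancy t h j)\<^sup>2 - 1 / (4 * scale)) =
      (\<Sum>j<K. walk_potential r (n - visits t j) (walk t h j)) -
      scale * (\<Sum>j<K. (discrepancy t h j)\<^sup>2) - real K / (4 * scale)"
      by (simp add: sum_subtractf sum_distrib_left)
    then show ?thesis
      unfolding potential_def drift_def by (simp only: ring_distribs mult.assoc)
  qed
  also have "\<dots> \<le> (\<Sum>i<t. regret_to_target h i) - s\<^sup>2 / 2 +
      s * (q * (\<Sum>j<K. W j 1) + (1 - q) * (\<Sum>j<K. W j 0)) -
      s * scale * (q * (\<Sum>j<K. D j 1) + (1 - q) * (\<Sum>j<K. D j 0) - miss / 2) - s * (real K / (4 * scale))"
    using mult_left_mono[OF W, of s] mult_left_mono[OF D, of "s * scale"] s scale_pos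
    by (simp add: right_diff_distrib distrib_left)
  also have "\<dots> \<le> (\<Sum>i<t. regret_to_target h i) - s\<^sup>2 / 2 +
      s * (q * (\<Sum>j<K. W j 1) + (1 - q) * (\<Sum>j<K. W j 0)) -
      s * scale * (q * (\<Sum>j<K. D j 1) + (1 - q) * (\<Sum>j<K. D j 0)) + (p - q)\<^sup>2 / 2 - s * (real K / (4 * scale))"
    using miss by (simp add: right_diff_distrib)
  also have "\<dots> = q * potential (Suc t) (h(t := (x, p, 1))) + (1 - q) * potential (Suc t) (h(t := (x, p, 0)))"
    unfolding pot P_def[symmetric] S_def[symmetric] Q_def[symmetric] by (simp add: field_simps power2_eq_square power4_eq_xxxx)
  finally show ?thesis by (simp add: q_def)
qed

end

section \<open>The comparison class and regularity of the potential\<close>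

lemma finite_H_star: "finite H_star" and H_star_nonempty: "H_star \<noteq> {}"
  by (simp_all add: H_star_def)

lemma H_star_range: "H_star \<subseteq> X_star \<rightarrow> {0..1}"
  by (auto simp: H_star_def X_star_def h_zero_def h_plus_def h_minus_def)

lemma H_star_measurable: "H_star \<subseteq> borel_measurable (instance_space X_star)"
proof -
  have "continuous_on UNIV h" if "h \<in> H_star" for h
    using that by (auto simp: H_star_def h_zero_def h_plus_def h_minus_def case_prod_beta' intro!: continuous_intros)
  then show ?thesis
    unfolding instance_space_def
    by (auto intro!: measurable_restrict_space1 borel_measurable_continuous_onI)
qed

lemma card_H_star_le: "card H_star \<le> 3"
  by (simp add: H_star_def card_insert_if)

context cycling_environment begin

lemma potential_cong:
  assumes "\<And>i. i < t \<Longrightarrow> snd (h i) = snd (h' i)"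
  shows "potential t h = potential t h'"
proof -
  have "walk t h = walk t h'" "discrepancy t h = discrepancy t h'"
    "(\<Sum>i<t. regret_to_target h i) = (\<Sum>i<t. regret_to_target h' i)"
    unfolding walk_def discrepancy_def regret_to_target_def noise_def fun_eq_iff
    using assms by (auto intro!: sum.cong)
  then show ?thesis by (simp add: potential_def)
qed

text \<open>The potential reads only forecasts and outcomes, of which there are finitely many
  sequences. Replacing every instance by a dummy maps the transcripts into a finite set without
  changing the potential.\<close>

lemma potential_bounded: "\<exists>B. \<forall>h\<in>space (transcript_space X N t). \<bar>potential t h\<bar> \<le> B"
proof -
  define S where "S = (\<Pi>\<^sub>E i\<in>{..<t}. {(0::real, 0::real)} \<times> forecast_grid N \<times> {0, 1::real})"
  have S: "finite S" unfolding S_def by (intro finite_PiE) auto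
  have "\<bar>potential t h\<bar> \<le> (\<Sum>h\<in>S. \<bar>potential t h\<bar>)" if h: "h \<in> space (transcript_space X N t)" for h
  proof -
    define h' where "h' = (\<lambda>i\<in>{..<t}. ((0::real, 0::real), snd (h i)))"
    have "snd (h i) \<in> forecast_grid N \<times> {0, 1}" if "i < t" for i
      using transcript_space_memD[OF h that] by (auto simp: space_round_space)
    then have "h' \<in> S" unfolding h'_def S_def by (intro restrict_PiE_iff[THEN iffD2]) auto
    then have "\<bar>potential t h'\<bar> \<le> (\<Sum>h\<in>S. \<bar>potential t h\<bar>)"
      using S by (intro member_le_sum[of h' S "\<lambda>h. \<bar>potential t h\<bar>"]) auto
    moreover have "potential t h = potential t h'"
      by (rule potential_cong) (simp add: h'_def)
    ultimately show ?thesis by simp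
  qed
  then show ?thesis by blast
qed

lemma measurable_potential: "potential t \<in> borel_measurable (transcript_space X N t)"
proof -
  have p: "(\<lambda>h. g (fst (snd (h i)))) \<in> borel_measurable (transcript_space X N t)" if "i < t" for i and g :: "real \<Rightarrow> real"
    by (rule measurable_compose[OF measurable_compose[OF measurable_transcript_component[OF that]
      measurable_round_forecast] borel_measurable_forecast_space])
  have y: "(\<lambda>h. noise h i) \<in> borel_measurable (transcript_space X N t)" if "i < t" for i
    unfolding noise_def
    by (rule measurable_compose[OF measurable_compose[OF measurable_transcript_component[OF that]
      measurable_round_outcome] borel_measurable_outcome_space])
  have R: "(\<lambda>h. \<Sum>i<t. regret_to_target h i) \<in> borel_measurable (transcript_space X N t)"
    unfolding regret_to_target_def
    using p[where g = "\<lambda>p. p"] y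
    by (intro borel_measurable_sum borel_measurable_diff borel_measurable_times borel_measurable_divide
        borel_measurable_power borel_measurable_const) auto
  have W: "(\<lambda>h. walk t h j) \<in> borel_measurable (transcript_space X N t)" for j
    unfolding walk_def using y
    by (intro borel_measurable_sum borel_measurable_times borel_measurable_const) auto
  have D: "(\<lambda>h. discrepancy t h j) \<in> borel_measurable (transcript_space X N t)" for j
    unfolding discrepancy_def
    using y p[where g = "\<lambda>p. of_bool (cell K p = int j) - of_bool (_ mod K = j)"]
    by (intro borel_measurable_sum borel_measurable_times) auto
  show ?thesis
    unfolding potential_def[abs_def] walk_potential_def
    by (intro borel_measurable_add borel_measurable_times borel_measurable_const borel_measurable_sum
        borel_measurable_diff borel_measurable_divide borel_measurable_power R W D)
qed

section \<open>From the potential to the swap regret\<close>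

lemma brier_loss_diff:
  "brier_loss p y - brier_loss (q + \<sigma> * s) y =
    (p - q)\<^sup>2 / 2 - (p - q) * (y - q) - \<sigma>\<^sup>2 * s\<^sup>2 / 2 + s * (\<sigma> * (y - q))"
  by (simp add: brier_loss_def power2_eq_square field_simps)

text \<open>On each cell the swap function shifts in the direction of the noise accumulated there
  and so collects \<open>s\<close> times its modulus. The potential was built from lower bounds of
  these moduli.\<close>

lemma potential_le_swap_regret:
  assumes \<omega>: "\<omega> \<in> space (transcript_space X_star N T)"
    and x: "\<And>t. t < T \<Longrightarrow> fst (\<omega> t) = (target t, s)"
    and n: "real (T div K) + 1 \<le> n"
  shows "potential T \<omega> \<le> swap_regret brier_loss H_star N T \<omega>"
proof -
  define U where "U j = (\<Sum>i<T. of_bool (cell K (fst (snd (\<omega> i))) = int j) * noise \<omega> i)" for j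
  \<comment> \<open>The sign of the noise on the cell, with ties sent to 1; the value 0 outside the
    \<open>K\<close> cells selects \<open>h_zero\<close>.\<close>
  define \<sigma> :: "int \<Rightarrow> real" where
    "\<sigma> c = (if 0 \<le> c \<and> c < int K then (if 0 \<le> U (nat c) then 1 else - 1) else 0)" for c
  define \<phi> where "\<phi> = (\<lambda>v\<in>forecast_grid N. if \<sigma> (cell K v) = 1 then h_plus
    else if \<sigma> (cell K v) = - 1 then h_minus else h_zero)"
  have \<phi>: "\<phi> \<in> forecast_grid N \<rightarrow>\<^sub>E H_star"
    by (auto simp: \<phi>_def H_star_def)
  have \<phi>_eq: "\<phi> v (q, s) = q + \<sigma> (cell K v) * s" if "v \<in> forecast_grid N" for v q
    using that by (simp add: \<phi>_def \<sigma>_def h_plus_def h_minus_def h_zero_def)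
  have \<sigma>_sum: "\<sigma> c * z = (\<Sum>j<K. \<sigma> (int j) * (of_bool (c = int j) * z))" for c z
  proof (cases "0 \<le> c \<and> c < int K")
    case True
    then have "(\<Sum>j<K. \<sigma> (int j) * (of_bool (c = int j) * z)) = (\<Sum>j<K. if nat c = j then \<sigma> c * z else 0)"
      by (intro sum.cong) auto
    then show ?thesis using True by (simp add: nat_less_iff)
  next
    case False
    then show ?thesis by (auto simp: \<sigma>_def)
  qed
  have U_split: "U j = walk T \<omega> j + discrepancy T \<omega> j" for j
    unfolding U_def walk_def discrepancy_def 
    by (simp only: sum.distrib[symmetric], rule sum.cong[OF refl]) (simp add: left_diff_distrib)
  have "walk_potential r (n - visits T j) (walk T \<omega> j) - scale * (discrepancy T \<omega> j)\<^sup>2 - 1 / (4 * scale)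
      \<le> \<bar>U j\<bar>" for j
  proof -
    \<comment> \<open>Since visits never exceed \<open>n\<close>, the leftover compensator only
      lowers the potential and may be dropped.\<close>
    have "0 \<le> 7/4 * (n - visits T j) * (walk T \<omega> j)\<^sup>2"
      using visits_le[OF order_refl n, of j] by simp
    then have "walk_potential r (n - visits T j) (walk T \<omega> j) \<le>
        (walk T \<omega> j)\<^sup>2 / r - walk T \<omega> j ^ 4 / (4 * r ^ 3)"
      unfolding walk_potential_def using r by (intro diff_left_mono divide_right_mono) auto
    also have "\<dots> \<le> \<bar>walk T \<omega> j\<bar>" by (rule abs_ge_quartic[OF r])
    finally show ?thesis
      using abs_le_quadratic[OF scale_pos, of "discrepancy T \<omega> j"] U_split[of j] by linarith
  qed
  then have "potential T \<omega> \<le> (\<Sum>i<T. regret_to_target \<omega> i) + s * (\<Sum>j<K. \<bar>U j\<bar>)"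
    unfolding potential_def using s by (intro add_left_mono mult_left_mono sum_mono) auto
  also have "(\<Sum>j<K. \<bar>U j\<bar>) = (\<Sum>i<T. \<sigma> (cell K (fst (snd (\<omega> i)))) * noise \<omega> i)"
  proof -
    have "(\<Sum>j<K. \<bar>U j\<bar>) = (\<Sum>j<K. \<sigma> (int j) * U j)"
      by (rule sum.cong) (auto simp: \<sigma>_def)
    also have "\<dots> = (\<Sum>j<K. \<Sum>i<T. \<sigma> (int j) * (of_bool (cell K (fst (snd (\<omega> i))) = int j) * noise \<omega> i))"
      by (simp only: U_def sum_distrib_left)
    also have "\<dots> = (\<Sum>i<T. \<sigma> (cell K (fst (snd (\<omega> i)))) * noise \<omega> i)"
      by (subst sum.swap) (simp only: \<sigma>_sum[symmetric])
    finally show ?thesis .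
  qed
  also have "(\<Sum>i<T. regret_to_target \<omega> i) + s * (\<Sum>i<T. \<sigma> (cell K (fst (snd (\<omega> i)))) * noise \<omega> i) =
      (\<Sum>i<T. regret_to_target \<omega> i + s * (\<sigma> (cell K (fst (snd (\<omega> i)))) * noise \<omega> i))"
    by (simp add: sum.distrib sum_distrib_left)
  also have "\<dots> \<le> (\<Sum>t<T. case \<omega> t of (x, p, y) \<Rightarrow> brier_loss p y - brier_loss (\<phi> p x) y)"
  proof (rule sum_mono)
    fix t assume "t \<in> {..<T}"
    then have t: "t < T" by simp
    obtain x p y where xpy: "\<omega> t = (x, p, y)" by (cases "\<omega> t")
    have p: "p \<in> forecast_grid N" and x': "x = (target t, s)"
      using transcript_space_memD[OF \<omega> t] x[OF t] by (auto simp: xpy space_round_space)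
    have "(\<sigma> (cell K p))\<^sup>2 * s\<^sup>2 \<le> 1 * s\<^sup>2"
      by (rule mult_right_mono) (simp_all add: \<sigma>_def)
    then show "regret_to_target \<omega> t + s * (\<sigma> (cell K (fst (snd (\<omega> t)))) * noise \<omega> t) \<le>
      (case \<omega> t of (x, p, y) \<Rightarrow> brier_loss p y - brier_loss (\<phi> p x) y)"
      using brier_loss_diff[of p y "target t" "\<sigma> (cell K p)"]
      by (simp add: xpy x' \<phi>_eq[OF p] regret_to_target_def noise_def)
  qed
  also have "\<dots> \<le> swap_regret brier_loss H_star N T \<omega>"
    unfolding swap_regret_def using \<phi> finite_swap_functions[OF finite_H_star, of N]
    by (intro cSUP_upper bdd_above_finite finite_imageI)
  finally show ?thesis .
qed

text \<open>The drift theorem is applied to the negative potential. The subtracted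
  \<open>4 * s\<^sup>2 * real K ^ 3\<close> comes from the initial value of the potential, that is,
  from the constants \<open>1 / (4 * scale)\<close>.\<close>

theorem expected_swap_regret_ge:
  assumes L: "L \<in> learners X_star N" and n: "real (T div K) + 1 \<le> n"
  shows "real T * drift - 4 * s\<^sup>2 * real K ^ 3 \<le> expected_swap_regret brier_loss X_star H_star N T L env"
proof -
  interpret forecasting_play X_star N L env
    using L env_in_environments by unfold_locales
  obtain B where B: "\<And>h. h \<in> space (transcript_space X_star N T) \<Longrightarrow> \<bar>potential T h\<bar> \<le> B"
    using potential_bounded by meson
  \<comment> \<open>Large enough to make up for the potential and the swap regret together as soon
    as one instance is off target.\<close>
  define M where "M = B + real T / 2"
  \<comment> \<open>Instances differ from the targets only with probability 0, yet the space of
    transcripts contains such plays. Penalizing them makes the comparison with the swap regret hold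
    on every transcript and adds nothing to the drift.\<close>
  define mism :: "nat \<Rightarrow> (real \<times> real) transcript \<Rightarrow> real" where
    "mism t h = (\<Sum>i<t. of_bool (fst (h i) \<noteq> (target i, s)))" for t h
  define f where "f t h = M * mism t h - potential t h" for t h
  have mism_meas: "mism t \<in> borel_measurable (transcript_space X_star N t)" for t
    unfolding mism_def[abs_def]
  proof (rule borel_measurable_sum)
    fix i assume "i \<in> {..<t}"
    then have "(\<lambda>h. fst (h i)) \<in> transcript_space X_star N t \<rightarrow>\<^sub>M instance_space X_star"
      by (intro measurable_compose[OF measurable_transcript_component measurable_round_fst]) simp
    moreover have "(\<lambda>x. of_bool (x \<noteq> (target i, s)) :: real) \<in> borel_measurable (instance_space X_star)"
      unfolding instance_space_def by (intro measurable_restrict_space1) measurable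
    ultimately show "(\<lambda>h. of_bool (fst (h i) \<noteq> (target i, s)) :: real) \<in> borel_measurable (transcript_space X_star N t)"
      by (rule measurable_compose)
  qed
  have f_meas: "f t \<in> borel_measurable (transcript_space X_star N t)" for t
    unfolding f_def[abs_def]
    by (intro borel_measurable_diff borel_measurable_times borel_measurable_const mism_meas measurable_potential)
  have f_bdd: "\<exists>B. \<forall>h\<in>space (transcript_space X_star N t). \<bar>f t h\<bar> \<le> B" for t
  proof -
    obtain C where C: "\<And>h. h \<in> space (transcript_space X_star N t) \<Longrightarrow> \<bar>potential t h\<bar> \<le> C"
      using potential_bounded by meson
    have "\<bar>f t h\<bar> \<le> \<bar>M\<bar> * real t + C" if "h \<in> space (transcript_space X_star N t)" for h
    proof -
      have "mism t h \<le> (\<Sum>i<t. 1)" unfolding mism_def by (rule sum_mono) simp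
      moreover have "0 \<le> mism t h" unfolding mism_def by (rule sum_nonneg) simp
      ultimately have "\<bar>M * mism t h\<bar> \<le> \<bar>M\<bar> * real t"
        unfolding abs_mult by (intro mult_left_mono) auto
      then show ?thesis unfolding f_def using C[OF that] by linarith
    qed
    then show ?thesis by blast
  qed
  have "integral\<^sup>L (play T) (f T) \<le> f 0 (\<lambda>_. undefined) + real T * (- drift)"
  proof (rule integral_play_le_drift[OF f_meas f_bdd])
    fix t h assume "t < T" and h: "h \<in> space (transcript_space X_star N t)"
    define F where "F = (\<lambda>r. f (Suc t) (h(t := r)))"
    define x where "x = (target t, s)"
    have x: "x \<in> X_star" unfolding x_def by (rule target_mem)
    obtain C where C: "\<And>h. h \<in> space (transcript_space X_star N (Suc t)) \<Longrightarrow> \<bar>f (Suc t) h\<bar> \<le> C"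
      using f_bdd by meson
    have F_meas: "F \<in> borel_measurable (round_space X_star N)"
      unfolding F_def by (rule measurable_compose[OF measurable_fun_upd_transcript[OF h] f_meas])
    have F_bdd: "\<bar>F r\<bar> \<le> C" if "r \<in> space (round_space X_star N)" for r
      unfolding F_def by (rule C[OF fun_upd_transcript_space[OF h that]])
    have q: "target t \<in> {0..1}" using target_bounds[of t] by simp
    interpret L: prob_space "L t h x" by (rule prob_space_forecast[OF h x])
    have L_sets: "sets (L t h x) = sets (forecast_space N)" by (rule prob_space_forecast[OF h x])
    have L_space: "space (L t h x) = forecast_grid N" using sets_eq_imp_space_eq[OF L_sets] by simp
    have "integral\<^sup>L (round_kernel X_star N L env t h) F =
        (\<integral>p. (\<integral>y. F (x, p, y) \<partial>bernoulli_outcome (target t)) \<partial>L t h x)"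
      unfolding integral_round_kernel[OF h F_meas F_bdd, simplified]
      using measurable_integral_round[OF h F_meas F_bdd]
      by (simp add: env_def x_def target_mem integral_return)
    also have "\<dots> = (\<integral>p. target t * F (x, p, 1) + (1 - target t) * F (x, p, 0) \<partial>L t h x)"
      by (simp only: integral_bernoulli_outcome[OF q])
    also have "\<dots> \<le> f t h + - drift"
    proof (rule L.integral_le_const)
      show "integrable (L t h x) (\<lambda>p. target t * F (x, p, 1) + (1 - target t) * F (x, p, 0))"
      proof (rule L.integrable_const_bound[where B = C])
        show "(\<lambda>p. target t * F (x, p, 1) + (1 - target t) * F (x, p, 0)) \<in> borel_measurable (L t h x)"
          using borel_measurable_forecast_space by (simp only: measurable_cong_sets[OF L_sets refl])
        show "AE p in L t h x. norm (target t * F (x, p, 1) + (1 - target t) * F (x, p, 0)) \<le> C"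
        proof (rule AE_I2)
          fix p assume "p \<in> space (L t h x)"
          then have "\<bar>F (x, p, 1)\<bar> \<le> C" "\<bar>F (x, p, 0)\<bar> \<le> C"
            using x by (auto intro!: F_bdd simp: space_round_space L_space)
          then have "\<bar>target t * F (x, p, 1)\<bar> + \<bar>(1 - target t) * F (x, p, 0)\<bar> \<le> target t * C + (1 - target t) * C"
            unfolding abs_mult using q by (intro add_mono mult_mono) auto
          then show "norm (target t * F (x, p, 1) + (1 - target t) * F (x, p, 0)) \<le> C"
            by (simp add: algebra_simps)
        qed
      qed
      show "AE p in L t h x. target t * F (x, p, 1) + (1 - target t) * F (x, p, 0) \<le> f t h + - drift"
      proof (rule AE_I2)
        fix p
        \<comment> \<open>The instance is the target here, so the penalty does not grow.\<close>
        have "mism (Suc t) (h(t := (x, p, y))) = mism t h" for y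
          by (auto simp: mism_def x_def intro!: sum.cong)
        then have F: "F (x, p, y) = M * mism t h - potential (Suc t) (h(t := (x, p, y)))" for y
          by (simp add: F_def f_def)
        show "target t * F (x, p, 1) + (1 - target t) * F (x, p, 0) \<le> f t h + - drift"
          using potential_drift[OF \<open>t < T\<close> n, of h x p] unfolding F f_def by (simp add: algebra_simps)
      qed
    qed
    finally show "(\<integral>r. f (Suc t) (h(t := r)) \<partial>round_kernel X_star N L env t h) \<le> f t h + - drift"
      by (simp add: F_def)
  qed
  moreover have "f 0 (\<lambda>_. undefined) = 4 * s\<^sup>2 * real K ^ 3"
    by (simp add: f_def mism_def potential_0)
  moreover have "- expected_swap_regret brier_loss X_star H_star N T L env \<le> integral\<^sup>L (play T) (f T)"
  proof -
    obtain C where C: "\<And>h. h \<in> space (transcript_space X_star N T) \<Longrightarrow> \<bar>f T h\<bar> \<le> C"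
      using f_bdd by meson
    have "(\<integral>h. - swap_regret brier_loss H_star N T h \<partial>play T) \<le> integral\<^sup>L (play T) (f T)"
    proof (rule integral_mono)
      show "integrable (play T) (\<lambda>h. - swap_regret brier_loss H_star N T h)"
        using integrable_swap_regret[OF finite_H_star H_star_nonempty H_star_measurable H_star_range] by simp
      show "integrable (play T) (f T)" by (rule integrable_play[OF f_meas C])
      fix h assume "h \<in> space (play T)"
      then have h: "h \<in> space (transcript_space X_star N T)" by simp
      show "- swap_regret brier_loss H_star N T h \<le> f T h"
      proof (cases "\<forall>t<T. fst (h t) = (target t, s)")
        case True
        then have "mism T h = 0" by (simp add: mism_def)
        then show ?thesis using potential_le_swap_regret[OF h _ n] True by (simp add: f_def)
      next
        case False
        then obtain t where t: "t < T" "fst (h t) \<noteq> (target t, s)" by blast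
        have "of_bool (fst (h t) \<noteq> (target t, s)) \<le> mism T h"
          unfolding mism_def using t by (intro member_le_sum) auto
        then have "1 \<le> mism T h" using t by simp
        moreover have "0 \<le> M" using B[OF h] by (simp add: M_def)
        ultimately have "M * 1 \<le> M * mism T h" by (intro mult_left_mono)
        then show ?thesis
          using B[OF h] swap_regret_bound[OF finite_H_star H_star_nonempty H_star_range h]
          M_def unfolding f_def by linarith
      qed
    qed
    then show ?thesis by (simp add: expected_swap_regret_def)
  qed
  ultimately show ?thesis by simp
qed

end

section \<open>The minimax rate\<close>

lemma cube_root_bounds:
  assumes T: "1 \<le> T"
  defines "\<tau> \<equiv> real T powr (1/3)" and "K \<equiv> nat \<lceil>real T powr (1/3)\<rceil>"
  shows "1 \<le> \<tau>" "\<tau> ^ 3 = real T" "1 \<le> K" "\<tau> \<le> real K" "real K \<le> 2 * \<tau>"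
proof -
  show 1: "1 \<le> \<tau>" unfolding \<tau>_def using T by (intro ge_one_powr_ge_zero) auto
  show "\<tau> ^ 3 = real T"
    unfolding \<tau>_def using T by (simp add: powr_realpow[symmetric] powr_powr)
  show "\<tau> \<le> real K" unfolding K_def \<tau>_def by (rule real_nat_ceiling_ge)
  then show "1 \<le> K" using 1 by linarith
  have "real K = \<lceil>\<tau>\<rceil>" unfolding K_def \<tau>_def[symmetric] using 1 by simp
  then show "real K \<le> 2 * \<tau>" using 1 by linarith
qed

text \<open>A grid size of order \<open>T powr (1/3)\<close> balances the two terms of the learner's
  bound: the bucket regrets grow like \<open>N\<close>, the rounding losses like \<open>T\<close>
  over the square of \<open>N\<close>.\<close>

lemma minimax_swap_regret_le:
  assumes T: "1 \<le> T"
  shows "minimax_swap_regret brier_loss X_star H_star T \<le> ereal (7 * real T powr (1/3))"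
proof -
  define \<tau> where "\<tau> = real T powr (1/3)"
  define N where "N = nat \<lceil>\<tau>\<rceil>"
  note b = cube_root_bounds[OF T, folded \<tau>_def, folded N_def]
  have "expected_swap_regret brier_loss X_star H_star N T (calibrating_learner H_star N) E \<le> 7 * \<tau>"
    if E: "E \<in> environments X_star N" for E
  proof -
    have ln: "ln (real (card H_star)) \<le> 2"
    proof -
      have "1 \<le> card H_star" using finite_H_star H_star_nonempty by (simp add: Suc_leI card_gt_0_iff)
      then have "ln (real (card H_star)) \<le> real (card H_star) - 1" by (intro ln_le_minus_one) simp
      then show ?thesis using card_H_star_le by linarith
    qed
    have "real T / (8 * (real N)\<^sup>2) \<le> real T / (8 * \<tau>\<^sup>2)"
      using b by (intro divide_left_mono mult_left_mono power_mono mult_pos_pos) auto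
    also have "\<dots> = \<tau> / 8"
      using b(1) by (simp add: b(2)[symmetric] power2_eq_square power3_eq_cube)
    finally have "real T / (8 * (real N)\<^sup>2) \<le> \<tau> / 8" .
    moreover have "(real N + 1) * ln (card H_star) \<le> (2 * \<tau> + 1) * 2"
      using b ln by (intro order_trans[OF mult_left_mono mult_right_mono]) auto
    ultimately have "(real N + 1) * ln (card H_star) + real T / (8 * (real N)\<^sup>2) \<le> (2 * \<tau> + 1) * 2 + \<tau> / 8"
      by (intro add_mono)
    also have "\<dots> \<le> 7 * \<tau>" using b(1) by simp
    finally show ?thesis
      by (rule order_trans[OF calibrating_learner_regret_le[OF b(3) finite_H_star H_star_nonempty
            H_star_measurable H_star_range E]])
  qed
  then have "(SUP E\<in>environments X_star N. ereal (expected_swap_regret brier_loss X_star H_star N T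
      (calibrating_learner H_star N) E)) \<le> ereal (7 * \<tau>)"
    by (intro SUP_least) simp
  then show ?thesis
    unfolding minimax_swap_regret_def \<tau>_def[symmetric]
    using b(3) calibrating_learner_in_learners[OF b(3) finite_H_star H_star_nonempty H_star_measurable H_star_range]
    by (intro INF_lower2[of N] INF_lower2[of "calibrating_learner H_star N"]) auto
qed

lemma minimax_swap_regret_ge:
  assumes T: "1 \<le> T"
  shows "ereal (1 / 100000 * real T powr (1/3)) \<le> minimax_swap_regret brier_loss X_star H_star T"
proof -
  define \<tau> where "\<tau> = real T powr (1/3)"
  define K where "K = nat \<lceil>\<tau>\<rceil>"
  note b = cube_root_bounds[OF T, folded \<tau>_def, folded K_def]
  \<comment> \<open>The gain is linear in \<open>s\<close>, while the shift price and the initial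
    value are quadratic; both losses are of order \<open>\<tau>\<close>, and the factor 2000 makes
    them small against the gain.\<close>
  define s where "s = 1 / (2000 * \<tau>)"
  \<comment> \<open>Of the order of the square root of \<open>n\<close>, and large enough for
    \<open>3 / (16 * r)\<close> to beat \<open>n / (4 * r ^ 3)\<close>: their values are 1/16 and
    1/54 divided by \<open>\<tau>\<close>.\<close>
  define r where "r = 3 * \<tau>"
  \<comment> \<open>A target has at most \<open>T div K + 1\<close> visits; the quotient is at most
    the square of \<open>\<tau>\<close>, and the factor 2 absorbs the extra visit.\<close>
  define n where "n = 2 * \<tau>\<^sup>2"
  interpret cycling_environment K s r n
  proof
    have "1 / (2000 * \<tau>) \<le> 1 / 8" using b(1) by (intro divide_left_mono) auto
    then show "s \<le> 1/8" by (simp add: s_def)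
  qed (use b in \<open>auto simp: s_def r_def\<close>)
  have n: "real (T div K) + 1 \<le> n"
  proof -
    have "real (T div K * K) \<le> real T" by (simp only: of_nat_le_iff div_times_less_eq_dividend)
    then have "real (T div K) \<le> real T / real K" using b(3) by (simp add: le_divide_eq)
    also have "\<dots> \<le> real T / \<tau>" using b by (intro divide_left_mono) auto
    also have "\<dots> = \<tau>\<^sup>2" using b(1) by (simp add: b(2)[symmetric] power2_eq_square power3_eq_cube)
    finally show ?thesis using one_le_power[OF b(1), of 2] by (simp add: n_def)
  qed
  have drift: "real T * drift = \<tau> * ((1/16 - 1/54) / 2000 - 1 / 8000000)"
    unfolding drift_def unfolding s_def r_def n_def b(2)[symmetric] using b(1)
    by (simp add: field_simps power2_eq_square power3_eq_cube)
  have le: "4 * s\<^sup>2 * real K ^ 3 \<le> 4 * s\<^sup>2 * (2 * \<tau>) ^ 3"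
    using b by (intro mult_left_mono power_mono) auto
  have eq: "4 * s\<^sup>2 * (2 * \<tau>) ^ 3 = \<tau> * (8 / 1000000)"
    using b(1) unfolding s_def by (simp add: field_simps power2_eq_square power3_eq_cube)
  have c: "1 / 100000 * \<tau> \<le> real T * drift - 4 * s\<^sup>2 * real K ^ 3"
    unfolding drift using le[unfolded eq] b(1) by simp
  show ?thesis
    unfolding minimax_swap_regret_def \<tau>_def[symmetric]
  proof (intro INF_greatest)
    fix N :: nat and L :: "(real \<times> real) learner"
    assume "L \<in> learners X_star N"
    then have "1 / 100000 * \<tau> \<le> expected_swap_regret brier_loss X_star H_star N T L env"
      by (rule order_trans[OF c expected_swap_regret_ge[OF _ n]])
    then show "ereal (1 / 100000 * \<tau>) \<le>
        (SUP E\<in>environments X_star N. ereal (expected_swap_regret brier_loss X_star H_star N T L E))"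
      by (intro SUP_upper2[OF env_in_environments]) simp
  qed
qed

theorem corollary4p8:
  shows "\<exists>(c::real) (C::real) (k::real) (T0::nat). c > 0 \<and> C > 0 \<and> k > 0 \<and>
    (\<forall>T\<ge>T0.
       ereal (c * real T powr (1/3)) \<le> minimax_swap_regret brier_loss X_star H_star T \<and>
       minimax_swap_regret brier_loss X_star H_star T
         \<le> ereal (C * real T powr (1/3) * ln (real T) powr k))"
proof (rule exI[of _ "1 / 100000"], rule exI[of _ 7], rule exI[of _ 1], rule exI[of _ 3], intro conjI allI impI)
  fix T :: nat assume T: "3 \<le> T"
  then show "ereal (1 / 100000 * real T powr (1/3)) \<le> minimax_swap_regret brier_loss X_star H_star T"
    by (intro minimax_swap_regret_ge) simp
  \<comment> \<open>The threshold 3 exceeds \<open>exp 1\<close>, so the logarithmic factor is at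
    least 1 and can be inserted into the log-free upper bound.\<close>
  have "1 \<le> ln (real T)"
    using T exp_le by (subst ln_ge_iff) auto
  then have "7 * real T powr (1/3) * 1 \<le> 7 * real T powr (1/3) * ln (real T) powr 1"
    by (intro mult_left_mono) auto
  then show "minimax_swap_regret brier_loss X_star H_star T \<le> ereal (7 * real T powr (1/3) * ln (real T) powr 1)"
    using T by (intro order_trans[OF minimax_swap_regret_le]) auto
qed simp_all

end
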